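(* For every $d\le 10$, the face vector $(f_0,\ldots,f_{d-1})$ of every cubical $d$-polytope is unimodal, i.e. there is an index $i$ with $f_0\le\cdots\le f_i$ and $f_i\ge\cdots\ge f_{d-1}$.
   Context: A $d$-polytope is cubical if every facet is combinatorially equivalent to the $(d-1)$-cube (equivalently, all proper faces are combinatorially cubes). Its face vector is $(f_0,\ldots,f_{d-1})$, where $f_i$ is the number of $i$-dimensional faces. *)

theory Defs
  imports "HOL-Analysis.Polytope"
begin

text \<open>
  Isomorphism of face lattices. The faces in the sense of \<^term>\<open>(face_of)\<close> include
  the empty face and the polytope itself.
\<close>
definition combinatorially_equivalent ::
    "'a::euclidean_space set \<Rightarrow> 'b::euclidean_space set \<Rightarrow> bool" where
  "combinatorially_equivalent P Q \<longleftrightarrow>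
     (\<exists>\<phi>. bij_betw \<phi> {F. F face_of P} {G. G face_of Q} \<and>
          (\<forall>F F'. F face_of P \<longrightarrow> F' face_of P \<longrightarrow> (F \<subseteq> F' \<longleftrightarrow> \<phi> F \<subseteq> \<phi> F')))"

text \<open>
  The unit cube spanned by a set \<open>B\<close> of standard basis vectors: \<open>[0,1]\<close> in the coordinates
  from \<open>B\<close> and \<open>0\<close> in all the others. It is a cube of dimension \<^term>\<open>card B\<close>, which allows
  cubes of every dimension up to \<open>DIM('a)\<close> inside one type.
\<close>
definition unit_cube :: "'a::euclidean_space set \<Rightarrow> 'a set" where
  "unit_cube B = cbox 0 (\<Sum>B)"

definition combinatorial_cube :: "nat \<Rightarrow> 'a::euclidean_space set \<Rightarrow> bool" where
  "combinatorial_cube k F \<longleftrightarrow>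
     (\<exists>B::'a set. B \<subseteq> Basis \<and> card B = k \<and> combinatorially_equivalent F (unit_cube B))"

text \<open>
  The dimension of a polytope is its affine dimension; the ambient space may be larger.
  A \<open>0\<close>-polytope has no facets, so the truncated subtraction is harmless.
\<close>
definition cubical_polytope :: "nat \<Rightarrow> 'a::euclidean_space set \<Rightarrow> bool" where
  "cubical_polytope d P \<longleftrightarrow>
     polytope P \<and> aff_dim P = int d \<and>
     (\<forall>F. F facet_of P \<longrightarrow> combinatorial_cube (d - 1) F)"

definition face_number :: "'a::euclidean_space set \<Rightarrow> nat \<Rightarrow> nat" where
  "face_number P i = card {F. F face_of P \<and> aff_dim F = int i}"

definition face_vector :: "nat \<Rightarrow> 'a::euclidean_space set \<Rightarrow> nat list" where
  "face_vector d P = map (face_number P) [0..<d]"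

text \<open>The empty sequence, which is the face vector of a \<open>0\<close>-polytope, counts as unimodal.\<close>
definition unimodal :: "'a::linorder list \<Rightarrow> bool" where
  "unimodal xs \<longleftrightarrow> xs = [] \<or>
     (\<exists>i<length xs. sorted_wrt (\<le>) (take (Suc i) xs) \<and> sorted_wrt (\<ge>) (drop i xs))"

end

theory Submission
  imports Defs "HOL-Computational_Algebra.Polynomial"
begin

text \<open>
  Order the facets of the cubical polytope \<open>P\<close> of dimension \<open>n + 1\<close> by a generic linear functional
  on the vertices of the polar polytope, and count every proper face at the lowest facet
  containing it. A face of a facet \<open>\<sigma>\<close> is counted at \<open>\<sigma>\<close> iff it lies in no ridge behind which there
  is a lower facet. As \<open>\<sigma>\<close> is a cube, its contribution to \<open>\<Sum>\<^sub>j f\<^sub>j t\<^sup>j\<close> is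
  \<open>t\<^sup>a (1 + t)\<^sup>b (2 + t)\<^sup>c\<close>, where \<open>a\<close>, \<open>b\<close>, \<open>c\<close> count the pairs of opposite ridges of which both,
  one or none have a lower facet behind them. Reversing the order exchanges \<open>a\<close> and \<open>c\<close>, so
  \<open>2 f\<^sub>j\<close> is a sum of coefficients of the polynomials
  \<open>(1 + t)\<^sup>b (t\<^sup>a (2 + t)\<^sup>c + t\<^sup>c (2 + t)\<^sup>a)\<close> with \<open>a + b + c = n\<close>. For \<open>n \<le> 8\<close> unimodality follows
  from linear inequalities between consecutive differences of the coefficients that hold for each
  of these polynomials; for \<open>n = 9\<close> one also needs \<open>f\<^sub>1 \<ge> 5 f\<^sub>0\<close>, which holds because every vertex
  lies on at least 10 edges.
\<close>

section \<open>Coefficient inequalities\<close>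

text \<open>A sum of unimodal sequences need not be unimodal, so what is added up over the facets
  has to be a linear inequality. With \<open>D j\<close> for the difference of the coefficients at
  \<open>j + 1\<close> and \<open>j\<close>, the form used is \<open>D (j + 1) <= r * D j\<close>,
  where \<open>r >= 0\<close> depends on \<open>n\<close> and \<open>j\<close> but not on
  \<open>a\<close>, \<open>b\<close>, \<open>c\<close>: it survives summation and makes a descent at
  \<open>j\<close> persist at \<open>j + 1\<close>. Without the reversed order no such
  \<open>r\<close> exists for \<open>n >= 3\<close>: the highest facet contributes
  \<open>t^n\<close>, whose single positive difference follows a zero one. The reversal pairs it
  with \<open>(2 + t)^n\<close>, whose negative differences absorb it. That reversal exactly
  complements the set of lower ridges rests on each ridge lying in exactly two facets.\<close>

text \<open>The peak is the first descent at or after \<open>k\<close>. Before it every step rises,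
  below \<open>k\<close> by \<open>up\<close> and from \<open>k\<close> on by minimality; after it
  descents persist by \<open>down\<close>.\<close>

lemma unimodal_mapI:
  fixes f :: "nat \<Rightarrow> 'a::linorder"
  assumes up: "\<And>j. j < k \<Longrightarrow> Suc j < d \<Longrightarrow> f j \<le> f (Suc j)"
    and down: "\<And>j. k \<le> j \<Longrightarrow> Suc (Suc j) < d \<Longrightarrow> f (Suc j) \<le> f j \<Longrightarrow> f (Suc (Suc j)) \<le> f (Suc j)"
  shows "unimodal (map f [0..<d])"
proof (cases "d = 0")
  case False
  \<comment> \<open>The clause \<open>Suc j = d\<close> provides the last index as peak when there
    is no descent.\<close>
  define Q where "Q = (\<lambda>j. k \<le> j \<and> f (Suc j) \<le> f j \<or> Suc j = d)"
  define i where "i = (LEAST j. Q j)"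
  have ex: "Q (d - 1)"
    using False by (simp add: Q_def)
  have i: "Q i"
    unfolding i_def by (rule LeastI, rule ex)
  have "i \<le> d - 1"
    unfolding i_def by (rule Least_le, rule ex)
  with False have "i < d" by simp
  have up': "f j \<le> f (Suc j)" if "j < i" for j
    using not_less_Least[OF that[unfolded i_def]] up[of j] that \<open>i < d\<close>
    unfolding Q_def by force
  have inc: "f j \<le> f l" if "j \<le> l" "l \<le> i" for j l
    using that
  proof (induction l rule: dec_induct)
    case (step l)
    with up'[of l] show ?case by (meson Suc_le_lessD less_imp_le order_trans)
  qed auto
  have step: "k \<le> j \<and> f (Suc j) \<le> f j" if "i \<le> j" "Suc j < d" for j
    using that
  proof (induction j rule: dec_induct)
    case base
    with i show ?case by (auto simp: Q_def)
  next
    case (step j)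
    with down[of j] show ?case by auto
  qed
  have dec: "f l \<le> f j" if "j \<le> l" "i \<le> j" "l < d" for j l
    using that
  proof (induction l rule: dec_induct)
    case (step l)
    with \<open>i \<le> j\<close> step.hyps have "f (Suc l) \<le> f l"
      using \<open>\<And>j. i \<le> j \<Longrightarrow> Suc j < d \<Longrightarrow> k \<le> j \<and> f (Suc j) \<le> f j\<close>[of l] by simp
    with step show ?case by (meson Suc_lessD order_trans)
  qed auto
  have "sorted_wrt (\<le>) (take (Suc i) (map f [0..<d]))"
    using inc \<open>i < d\<close> by (auto simp: sorted_wrt_iff_nth_less)
  moreover have "sorted_wrt (\<ge>) (drop i (map f [0..<d]))"
    using dec by (auto simp: sorted_wrt_iff_nth_less)
  ultimately show ?thesis
    using \<open>i < d\<close> by (auto simp: unimodal_def)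
qed (simp add: unimodal_def)

text \<open>
  The generating function of the faces of an \<open>(a + b + c)\<close>-cube that avoid a set of facets
  containing both, one or none of the two opposite facets in \<open>a\<close>, \<open>b\<close> and \<open>c\<close> directions.
\<close>
definition box_poly :: "nat \<Rightarrow> nat \<Rightarrow> nat \<Rightarrow> int poly" where
  "box_poly a b c = [:0, 1:] ^ a * [:1, 1:] ^ b * [:2, 1:] ^ c"

definition sym_coeff :: "nat \<Rightarrow> nat \<Rightarrow> nat \<Rightarrow> nat \<Rightarrow> int" where
  "sym_coeff a b c j = coeff (box_poly a b c + box_poly c b a) j"

text \<open>Coefficient lists, with the constant term first; \<open>y\<close> is the carry from the previous entry.\<close>
fun mul_lin :: "int \<Rightarrow> int \<Rightarrow> int list \<Rightarrow> int list" where
  "mul_lin k y [] = [y]"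
| "mul_lin k y (x # xs) = (y + k * x) # mul_lin k x xs"

fun mul_lin_pow :: "int \<Rightarrow> nat \<Rightarrow> int list \<Rightarrow> int list" where
  "mul_lin_pow k 0 xs = xs"
| "mul_lin_pow k (Suc m) xs = mul_lin k 0 (mul_lin_pow k m xs)"

lemma Poly_mul_lin: "Poly (mul_lin k y xs) = [:y:] + [:k, 1:] * Poly xs"
  by (induction k y xs rule: mul_lin.induct) auto

lemma Poly_mul_lin_pow: "Poly (mul_lin_pow k m xs) = [:k, 1:] ^ m * Poly xs"
  by (induction m) (simp_all add: Poly_mul_lin mult.assoc del: mult_pCons_left)

text \<open>\<open>box_poly\<close> in a form that \<open>code_simp\<close> can evaluate. The list
  is never trimmed, so all lists for one \<open>n\<close> have length \<open>n + 1\<close>.\<close>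

definition box_list :: "nat \<Rightarrow> nat \<Rightarrow> nat \<Rightarrow> int list" where
  "box_list a b c = mul_lin_pow 0 a (mul_lin_pow 1 b (mul_lin_pow 2 c [1]))"

lemma length_mul_lin [simp]: "length (mul_lin k y xs) = Suc (length xs)"
  by (induction k y xs rule: mul_lin.induct) auto

lemma length_mul_lin_pow [simp]: "length (mul_lin_pow k m xs) = m + length xs"
  by (induction m) auto

lemma length_box_list [simp]: "length (box_list a b c) = Suc (a + b + c)"
  by (simp add: box_list_def)

lemma sym_coeff_eq_nth:
  assumes "j \<le> a + b + c"
  shows "sym_coeff a b c j = map2 (+) (box_list a b c) (box_list c b a) ! j"
proof -
  have "coeff (box_poly a b c) j = box_list a b c ! j" if "j \<le> a + b + c" for a b c
  proof -
    have "box_poly a b c = Poly (box_list a b c)"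
      by (simp add: box_poly_def box_list_def Poly_mul_lin_pow mult.assoc one_pCons)
    then show ?thesis
      using that by (simp add: coeff_Poly_eq nth_default_def)
  qed
  from this[of a b c] this[of c b a] assms show ?thesis
    by (simp add: sym_coeff_def)
qed

section \<open>Finite checks on coefficient lists\<close>

fun increasing_steps :: "nat \<Rightarrow> int list \<Rightarrow> bool" where
  "increasing_steps (Suc k) (x # y # xs) \<longleftrightarrow> x \<le> y \<and> increasing_steps k (y # xs)"
| "increasing_steps _ _ \<longleftrightarrow> True"

lemma increasing_stepsD:
  "increasing_steps k xs \<Longrightarrow> j < k \<Longrightarrow> Suc j < length xs \<Longrightarrow> xs ! j \<le> xs ! Suc j"
proof (induction k xs arbitrary: j rule: increasing_steps.induct)
  case (1 k x y xs)
  then show ?case by (cases j) auto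
qed auto

text \<open>The factor 2 lets half-integral ratios be stored as integers. Past the end of
  \<open>ls\<close> the default 0 demands outright that the sequence does not rise.\<close>

fun difference_bounds :: "int list \<Rightarrow> int list \<Rightarrow> bool" where
  "difference_bounds ls (x # y # z # xs) \<longleftrightarrow>
     2 * (z - y) \<le> nth_default 0 ls 0 * (y - x) \<and> difference_bounds (tl ls) (y # z # xs)"
| "difference_bounds _ _ \<longleftrightarrow> True"

lemma difference_boundsD:
  "difference_bounds ls xs \<Longrightarrow> Suc (Suc j) < length xs \<Longrightarrow>
     2 * (xs ! Suc (Suc j) - xs ! Suc j) \<le> nth_default 0 ls j * (xs ! Suc j - xs ! j)"
proof (induction ls xs arbitrary: j rule: difference_bounds.induct)
  case (1 ls x y z xs)
  have "nth_default 0 (tl ls) i = nth_default 0 ls (Suc i)" for i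
    by (cases ls) (auto simp: nth_default_def)
  with 1 show ?case by (cases j) auto
qed auto

text \<open>
  Ratios \<open>\<lambda>\<close>, found by linear programming, such that consecutive differences \<open>D\<^sub>j\<close> of
  \<open>sym_coeff a b c\<close> satisfy \<open>2 * D\<^sub>j\<^sub>+\<^sub>1 \<le> \<lambda> * D\<^sub>j\<close> for all \<open>a + b + c = n\<close>; the entry at position \<open>i\<close>
  belongs to \<open>j = bounds_from n + i\<close>, and missing entries are \<open>0\<close>. No such ratio exists for
  \<open>n = 9\<close> and \<open>j = 3\<close>: there the triples \<open>(0, 0, 9)\<close> and \<open>(4, 1, 4)\<close> conflict, and the bound on the
  number of edges is needed in addition.
\<close>
definition difference_ratios :: "nat \<Rightarrow> int list" where
  "difference_ratios n = (if n = 6 then [2] else if n = 7 then [4] else if n = 8 then [2]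
     else if n = 9 then [1] else [])"

definition bounds_from :: "nat \<Rightarrow> nat" where
  "bounds_from n = (if n = 9 then 4 else (n + 1) div 3)"

lemma difference_ratios_nonneg: "0 \<le> nth_default 0 (difference_ratios n) j"
  by (auto simp: difference_ratios_def nth_default_Cons split: nat.split)

text \<open>The range ends where the coefficients of \<open>(2 + t)^n\<close>, contributed by the
  triple \<open>(0, 0, n)\<close>, begin to fall.\<close>

lemma sym_coeff_up:
  assumes "a + b + c = n" "n \<le> 9" "j < (n + 1) div 3"
  shows "sym_coeff a b c j \<le> sym_coeff a b c (Suc j)"
proof -
  have mem: "n \<in> set [0..<10]" "a \<in> set [0..<Suc n]" "c \<in> set [0..<Suc n - a]" "b = n - a - c"
    using assms by auto
  \<comment> \<open>With \<open>b\<close> eliminated this is a closed statement about the 220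
    triples of sum at most 9.\<close>
  have "\<forall>n\<in>set [0..<10]. \<forall>a\<in>set [0..<Suc n]. \<forall>c\<in>set [0..<Suc n - a].
      increasing_steps ((n + 1) div 3)
        (map2 (+) (box_list a (n - a - c) c) (box_list c (n - a - c) a))"
    by code_simp
  then have "increasing_steps ((n + 1) div 3) (map2 (+) (box_list a b c) (box_list c b a))"
    using mem(1-3) unfolding mem(4) by blast
  from increasing_stepsD[OF this, of j] assms show ?thesis
    by (simp add: sym_coeff_eq_nth del: nth_map)
qed

lemma sym_coeff_down:
  assumes "a + b + c = n" "n \<le> 9" "bounds_from n \<le> j" "Suc j < n"
  shows "2 * (sym_coeff a b c (Suc (Suc j)) - sym_coeff a b c (Suc j))
    \<le> nth_default 0 (difference_ratios n) (j - bounds_from n) * (sym_coeff a b c (Suc j) - sym_coeff a b c j)"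
proof -
  define xs where "xs = map2 (+) (box_list a b c) (box_list c b a)"
  have mem: "n \<in> set [0..<10]" "a \<in> set [0..<Suc n]" "c \<in> set [0..<Suc n - a]" "b = n - a - c"
    using assms by auto
  have "\<forall>n\<in>set [0..<10]. \<forall>a\<in>set [0..<Suc n]. \<forall>c\<in>set [0..<Suc n - a].
      difference_bounds (difference_ratios n)
        (drop (bounds_from n) (map2 (+) (box_list a (n - a - c) c) (box_list c (n - a - c) a)))"
    by code_simp
  then have "difference_bounds (difference_ratios n) (drop (bounds_from n) xs)"
    using mem(1-3) unfolding mem(4) xs_def by blast
  moreover have "length xs = Suc n"
    using assms by (simp add: xs_def)
  moreover have "bounds_from n + Suc (j - bounds_from n) = Suc j"
    "bounds_from n + Suc (Suc (j - bounds_from n)) = Suc (Suc j)"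
    using assms by auto
  ultimately have "2 * (xs ! Suc (Suc j) - xs ! Suc j)
      \<le> nth_default 0 (difference_ratios n) (j - bounds_from n) * (xs ! Suc j - xs ! j)"
    using difference_boundsD[of "difference_ratios n" "drop (bounds_from n) xs" "j - bounds_from n"] assms by simp
  then show ?thesis
    using assms by (simp add: sym_coeff_eq_nth xs_def del: nth_map)
qed

text \<open>Divide by 8. The triple \<open>(4, 1, 4)\<close> has differences 32 and 64 at positions
  3 and 4 and vanishing low coefficients, which requires a ratio of at least 2. For
  \<open>(0, 0, 9)\<close> the differences are -1344 and -2016, which violates ratio 2; the defect
  2304 - 5 * 512 = -256 repairs this once it is weighted by 21 / 8. Both triples give
  equality.\<close>

lemma sym_coeff_down_9_3:
  assumes "a + b + c = 9"
  shows "8 * (sym_coeff a b c 5 - sym_coeff a b c 4) + 21 * (sym_coeff a b c 1 - 5 * sym_coeff a b c 0)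
    \<le> 16 * (sym_coeff a b c 4 - sym_coeff a b c 3)"
proof -
  have mem: "a \<in> set [0..<10]" "c \<in> set [0..<10 - a]" "b = 9 - a - c"
    using assms by auto
  have "\<forall>a\<in>set [0..<10]. \<forall>c\<in>set [0..<10 - a].
     (\<lambda>xs. 8 * (xs ! 5 - xs ! 4) + 21 * (xs ! 1 - 5 * xs ! 0) \<le> 16 * (xs ! 4 - xs ! 3))
       (map2 (+) (box_list a (9 - a - c) c) (box_list c (9 - a - c) a))"
    by code_simp
  then have "(\<lambda>xs. 8 * (xs ! 5 - xs ! 4) + 21 * (xs ! 1 - 5 * xs ! 0) \<le> 16 * (xs ! 4 - xs ! 3))
       (map2 (+) (box_list a (9 - a - c) c) (box_list c (9 - a - c) a))"
    using mem(1-2) by blast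
  moreover have "9 - a - c = b"
    using assms by simp
  ultimately show ?thesis
    using assms by (simp add: sym_coeff_eq_nth del: nth_map)
qed

lemma unimodal_from_box_polys:
  fixes S :: "'s set" and f :: "nat \<Rightarrow> nat"
  assumes "n \<le> 9"
    and abc: "\<And>s. s \<in> S \<Longrightarrow> a s + b s + c s = n"
    and f: "\<And>j. j \<le> n \<Longrightarrow> 2 * int (f j) = (\<Sum>s\<in>S. sym_coeff (a s) (b s) (c s) j)"
    and deg: "n = 9 \<Longrightarrow> 10 * f 0 \<le> 2 * f 1"
  shows "unimodal (map f [0..<Suc n])"
proof (rule unimodal_mapI)
  define F where "F = (\<lambda>j. \<Sum>s\<in>S. sym_coeff (a s) (b s) (c s) j)"
  have fF: "2 * int (f j) = F j" if "j \<le> n" for j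
    using f[OF that] by (simp add: F_def)
  show "f j \<le> f (Suc j)" if "j < (n + 1) div 3" "Suc j < Suc n" for j
  proof -
    have "F j \<le> F (Suc j)"
      unfolding F_def using that assms by (intro sum_mono sym_coeff_up[where n = n]) auto
    then show ?thesis
      using fF[of j] fF[of "Suc j"] that by simp
  qed
  show "f (Suc (Suc j)) \<le> f (Suc j)"
    if j: "(n + 1) div 3 \<le> j" "Suc (Suc j) < Suc n" "f (Suc j) \<le> f j" for j
  proof -
    have le: "F (Suc j) \<le> F j"
      using fF[of j] fF[of "Suc j"] j by simp
    have "F (Suc (Suc j)) \<le> F (Suc j)"
    \<comment> \<open>For \<open>n = 9\<close> descents may start at 3, but
      \<open>bounds_from 9\<close> is 4; the gap is closed by the bound on the number of
      edges.\<close>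
    proof (cases "n = 9 \<and> j = 3")
      case True
      have "(\<Sum>s\<in>S. 8 * (sym_coeff (a s) (b s) (c s) 5 - sym_coeff (a s) (b s) (c s) 4)
               + 21 * (sym_coeff (a s) (b s) (c s) 1 - 5 * sym_coeff (a s) (b s) (c s) 0))
            \<le> (\<Sum>s\<in>S. 16 * (sym_coeff (a s) (b s) (c s) 4 - sym_coeff (a s) (b s) (c s) 3))"
        using abc True by (intro sum_mono sym_coeff_down_9_3) auto
      then have "8 * (F 5 - F 4) + 21 * (F 1 - 5 * F 0) \<le> 16 * (F 4 - F 3)"
        by (simp add: F_def sum.distrib sum_subtractf flip: sum_distrib_left)
      moreover have "5 * F 0 \<le> F 1"
        using deg fF[of 0] fF[of 1] True by simp
      ultimately show ?thesis
        using le True by (simp add: eval_nat_numeral)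
    next
      case False
      have "(\<Sum>s\<in>S. 2 * (sym_coeff (a s) (b s) (c s) (Suc (Suc j)) - sym_coeff (a s) (b s) (c s) (Suc j)))
        \<le> (\<Sum>s\<in>S. nth_default 0 (difference_ratios n) (j - bounds_from n) * (sym_coeff (a s) (b s) (c s) (Suc j) - sym_coeff (a s) (b s) (c s) j))"
        using abc False j assms(1) by (intro sum_mono sym_coeff_down) (auto simp: bounds_from_def)
      then have "2 * (F (Suc (Suc j)) - F (Suc j)) \<le> nth_default 0 (difference_ratios n) (j - bounds_from n) * (F (Suc j) - F j)"
        by (simp add: F_def sum.distrib sum_subtractf flip: sum_distrib_left)
      moreover have "nth_default 0 (difference_ratios n) (j - bounds_from n) * (F (Suc j) - F j) \<le> 0"
        using le by (intro mult_nonneg_nonpos) (auto simp: difference_ratios_nonneg)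
      ultimately show ?thesis by simp
    qed
    then show ?thesis
      using fF[of "Suc j"] fF[of "Suc (Suc j)"] j by simp
  qed
qed

section \<open>Faces of cubes\<close>

text \<open>Descending from \<open>F\<close> through facets to the empty face lowers the dimension
  by exactly one each time, while the images shrink strictly and so lose at least one.\<close>

lemma strict_mono_faces_aff_dim_le:
  fixes P :: "'a::euclidean_space set" and Q :: "'b::euclidean_space set"
  assumes "polytope P" and "polytope Q"
    and face: "\<And>F. F face_of P \<Longrightarrow> \<phi> F face_of Q"
    and mono: "\<And>F F'. F face_of P \<Longrightarrow> F' face_of P \<Longrightarrow> F \<subset> F' \<Longrightarrow> \<phi> F \<subset> \<phi> F'"
    and "F face_of P"
  shows "aff_dim F \<le> aff_dim (\<phi> F)"
  using \<open>F face_of P\<close>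
proof (induction "nat (aff_dim F + 1)" arbitrary: F rule: less_induct)
  case less
  show ?case
  proof (cases "F = {}")
    case True
    then show ?thesis by (simp add: aff_dim_geq)
  next
    case False
    have polyF: "polytope F"
      using face_of_polytope_polytope less.prems assms(1) by blast
    have nonneg: "aff_dim F \<ge> 0"
      using False aff_dim_geq[of F] aff_dim_empty[of F] by linarith
    \<comment> \<open>Below a point comes the empty face, of dimension -1; hence also the shift in
      the induction measure.\<close>
    have "\<exists>G. G face_of F \<and> G \<noteq> F \<and> aff_dim G = aff_dim F - 1"
    proof (cases "aff_dim F = 0")
      case True
      with False show ?thesis by (intro exI[of _ "{}"]) auto
    next
      case False
      then obtain G where "G facet_of F"
        using polytope_facet_exists[OF polyF] nonneg by force
      then show ?thesis
        by (intro exI[of _ G]) (auto simp: facet_of_def)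
    qed
    then obtain G where G: "G face_of F" "G \<noteq> F" "aff_dim G = aff_dim F - 1"
      by blast
    then have GP: "G face_of P"
      using less.prems face_of_trans by blast
    have "G \<subset> F"
      using G face_of_imp_subset by blast
    then have sub: "\<phi> G \<subset> \<phi> F"
      using GP less.prems mono by blast
    have "\<phi> G face_of \<phi> F"
      using face[OF GP] face[OF less.prems] sub by (meson face_of_face psubset_imp_subset)
    moreover have "convex (\<phi> F)"
      using face[OF less.prems] face_of_imp_convex by blast
    ultimately have "aff_dim (\<phi> G) < aff_dim (\<phi> F)"
      using face_of_aff_dim_lt sub by blast
    moreover have "aff_dim G \<le> aff_dim (\<phi> G)"
      using G GP nonneg by (intro less.hyps) auto
    ultimately show ?thesis
      using G by linarith
  qed
qed

text \<open>Combinatorial equivalence mentions inclusion only. Dimensions follow by applying the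
  previous bound to the isomorphism and to its inverse.\<close>

lemma iso_faces_aff_dim_eq:
  fixes P :: "'a::euclidean_space set" and Q :: "'b::euclidean_space set"
  assumes "polytope P" and "polytope Q"
    and bij: "bij_betw \<phi> {F. F face_of P} {G. G face_of Q}"
    and iff: "\<And>F F'. F face_of P \<Longrightarrow> F' face_of P \<Longrightarrow> F \<subseteq> F' \<longleftrightarrow> \<phi> F \<subseteq> \<phi> F'"
    and "F face_of P"
  shows "aff_dim (\<phi> F) = aff_dim F"
proof (rule antisym)
  let ?\<psi> = "inv_into {F. F face_of P} \<phi>"
  have face: "\<phi> F face_of Q" if "F face_of P" for F
    using bij that by (auto dest: bij_betwE)
  show "aff_dim F \<le> aff_dim (\<phi> F)"
    using assms face
    by (intro strict_mono_faces_aff_dim_le[of P Q]) (auto simp: less_le_not_le)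
  have bij': "bij_betw ?\<psi> {G. G face_of Q} {F. F face_of P}"
    using bij bij_betw_inv_into by blast
  have face': "?\<psi> G face_of P" if "G face_of Q" for G
    using bij' that by (auto dest: bij_betwE)
  have inv: "\<phi> (?\<psi> G) = G" if "G face_of Q" for G
    using bij that by (simp add: bij_betw_inv_into_right)
  have "aff_dim (\<phi> F) \<le> aff_dim (?\<psi> (\<phi> F))"
  proof (rule strict_mono_faces_aff_dim_le[of Q P])
    show "?\<psi> G \<subset> ?\<psi> G'" if "G face_of Q" "G' face_of Q" "G \<subset> G'" for G G'
      using that iff[of "?\<psi> G" "?\<psi> G'"] iff[of "?\<psi> G'" "?\<psi> G"] face' inv
      by (auto simp: less_le_not_le)
  qed (use assms face face' in auto)
  also have "?\<psi> (\<phi> F) = F"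
    using bij \<open>F face_of P\<close> by (simp add: bij_betw_inv_into_left)
  finally show "aff_dim (\<phi> F) \<le> aff_dim F" .
qed

text \<open>
  A nonempty face of a cube is encoded by the set \<open>L\<close> of coordinates fixed at the lower end and the
  set \<open>U\<close> of those fixed at the upper end.
\<close>
definition sign_pairs :: "'a set \<Rightarrow> ('a set \<times> 'a set) set" where
  "sign_pairs B = {(L, U). L \<subseteq> B \<and> U \<subseteq> B \<and> L \<inter> U = {}}"

definition cube_face :: "'a::euclidean_space set \<Rightarrow> 'a set \<times> 'a set \<Rightarrow> 'a set" where
  "cube_face B = (\<lambda>(L, U). {x \<in> unit_cube B. (\<forall>i\<in>L. x \<bullet> i = 0) \<and> (\<forall>i\<in>U. x \<bullet> i = 1)})"

lemma mem_unit_cube: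
  assumes "B \<subseteq> Basis"
  shows "x \<in> unit_cube B \<longleftrightarrow> (\<forall>i\<in>B. 0 \<le> x \<bullet> i \<and> x \<bullet> i \<le> 1) \<and> (\<forall>i\<in>Basis - B. x \<bullet> i = 0)"
proof -
  have "finite B"
    using assms finite_Basis finite_subset by metis
  have *: "\<Sum>B \<bullet> i = (if i \<in> B then 1 else 0)" if "i \<in> Basis" for i
  proof -
    have "\<Sum>B \<bullet> i = (\<Sum>b\<in>B. if b = i then 1 else 0)"
      unfolding inner_sum_left using assms that by (intro sum.cong) (auto simp: inner_Basis)
    then show ?thesis
      using \<open>finite B\<close> by simp
  qed
  have "x \<in> unit_cube B \<longleftrightarrow> (\<forall>i\<in>Basis. 0 \<le> x \<bullet> i \<and> x \<bullet> i \<le> (if i \<in> B then 1 else 0))"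
    by (simp add: unit_cube_def mem_box *)
  also have "\<dots> \<longleftrightarrow> (\<forall>i\<in>B. 0 \<le> x \<bullet> i \<and> x \<bullet> i \<le> (if i \<in> B then 1 else 0))
      \<and> (\<forall>i\<in>Basis - B. 0 \<le> x \<bullet> i \<and> x \<bullet> i \<le> (if i \<in> B then 1 else 0))"
    using assms by blast
  also have "\<dots> \<longleftrightarrow> (\<forall>i\<in>B. 0 \<le> x \<bullet> i \<and> x \<bullet> i \<le> 1) \<and> (\<forall>i\<in>Basis - B. x \<bullet> i = 0)"
    by (intro arg_cong2[where f = conj] ball_cong refl) auto
  finally show ?thesis .
qed

lemma convex_bounds_eq:
  fixes a b t :: real
  assumes "0 < t" "t < 1" "a \<le> m" "b \<le> m" "(1 - t) * a + t * b = m"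
  shows "a = m \<and> b = m"
proof -
  have "(1 - t) * (m - a) + t * (m - b) = 0"
    using assms by (simp add: algebra_simps)
  moreover have "(1 - t) * (m - a) \<ge> 0" "t * (m - b) \<ge> 0"
    using assms by auto
  ultimately have "(1 - t) * (m - a) = 0" "t * (m - b) = 0"
    by linarith+
  then show ?thesis
    using assms by auto
qed

lemma cube_face_face_of:
  assumes "B \<subseteq> Basis" "s \<in> sign_pairs B"
  shows "cube_face B s face_of unit_cube B"
proof -
  obtain L U where s: "s = (L, U)" "L \<subseteq> B" "U \<subseteq> B"
    using assms by (auto simp: sign_pairs_def)
  have "convex (cube_face B s)"
  proof -
    have "cube_face B s = unit_cube B \<inter> ((\<Inter>i\<in>L. {x. i \<bullet> x = 0}) \<inter> (\<Inter>i\<in>U. {x. i \<bullet> x = 1}))"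
      by (auto simp: cube_face_def s inner_commute)
    then show ?thesis
      by (auto simp: unit_cube_def intro!: convex_Int convex_INT convex_hyperplane)
  qed
  moreover have "a \<in> cube_face B s \<and> b \<in> cube_face B s"
    if ab: "a \<in> unit_cube B" "b \<in> unit_cube B" and x: "x \<in> cube_face B s" "x \<in> open_segment a b"
    for a b x
  proof -
    obtain t where t: "0 < t" "t < 1" "x = (1 - t) *\<^sub>R a + t *\<^sub>R b"
      using x by (auto simp: in_segment)
    have "a \<bullet> i = 0 \<and> b \<bullet> i = 0" if "i \<in> L" for i
    proof -
      \<comment> \<open>Negation turns the lower bound 0 into the upper bound that
        \<open>convex_bounds_eq\<close> expects.\<close>
      have "(1 - t) * (- (a \<bullet> i)) + t * (- (b \<bullet> i)) = 0"
        using x that t by (simp add: cube_face_def s inner_simps algebra_simps)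
      from convex_bounds_eq[OF t(1,2) _ _ this] show ?thesis
        using ab that s mem_unit_cube[OF assms(1)] by auto
    qed
    moreover have "a \<bullet> i = 1 \<and> b \<bullet> i = 1" if "i \<in> U" for i
    proof -
      have "(1 - t) * (a \<bullet> i) + t * (b \<bullet> i) = 1"
        using x that t by (simp add: cube_face_def s inner_simps)
      from convex_bounds_eq[OF t(1,2) _ _ this] show ?thesis
        using ab that s mem_unit_cube[OF assms(1)] by auto
    qed
    ultimately show ?thesis
      using ab by (auto simp: cube_face_def s)
  qed
  moreover have "cube_face B s \<subseteq> unit_cube B"
    by (auto simp: cube_face_def s)
  ultimately show ?thesis
    unfolding face_of_def by blast
qed

text \<open>The barycentre of a face. The value 1/2 in the free directions makes \<open>L\<close>
  and \<open>U\<close> recoverable from this one point, so testing it decides inclusion of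
  faces.\<close>

definition cube_center :: "'a::euclidean_space set \<Rightarrow> 'a set \<times> 'a set \<Rightarrow> 'a" where
  "cube_center B = (\<lambda>(L, U). \<Sum>i\<in>B. (if i \<in> L then 0 else if i \<in> U then 1 else 1/2) *\<^sub>R i)"

lemma inner_cube_center:
  assumes "B \<subseteq> Basis" "i \<in> Basis"
  shows "cube_center B (L, U) \<bullet> i =
    (if i \<in> B then if i \<in> L then 0 else if i \<in> U then 1 else 1/2 else 0)"
proof -
  have "finite B"
    using assms finite_Basis finite_subset by metis
  have "cube_center B (L, U) \<bullet> i = (\<Sum>j\<in>B. if j = i then
      (if j \<in> L then 0 else if j \<in> U then 1 else 1/2) else 0)"
    unfolding cube_center_def inner_sum_left prod.case
    using assms by (intro sum.cong) (auto simp: inner_Basis)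
  also have "\<dots> = (if i \<in> B then if i \<in> L then 0 else if i \<in> U then 1 else 1/2 else 0)"
    using \<open>finite B\<close> by (subst sum.delta) auto
  finally show ?thesis .
qed

lemma cube_center_in_face:
  assumes "B \<subseteq> Basis" "s \<in> sign_pairs B"
  shows "cube_center B s \<in> cube_face B s"
proof -
  obtain L U where s: "s = (L, U)" "L \<subseteq> B" "U \<subseteq> B" "L \<inter> U = {}"
    using assms by (auto simp: sign_pairs_def)
  have "i \<in> Basis" if "i \<in> B" for i
    using that assms by blast
  moreover have "i \<in> B" "i \<notin> L" if "i \<in> U" for i
    using s that by auto
  moreover have "i \<in> B" if "i \<in> L" for i
    using s that by auto
  ultimately show ?thesis
    using assms(1) by (simp add: s cube_face_def mem_unit_cube inner_cube_center)
qed

lemma cube_face_subset_iff: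
  assumes "B \<subseteq> Basis" "(L, U) \<in> sign_pairs B" "(L', U') \<in> sign_pairs B"
  shows "cube_face B (L, U) \<subseteq> cube_face B (L', U') \<longleftrightarrow> L' \<subseteq> L \<and> U' \<subseteq> U"
proof
  assume "cube_face B (L, U) \<subseteq> cube_face B (L', U')"
  with cube_center_in_face[OF assms(1,2)] have c: "cube_center B (L, U) \<in> cube_face B (L', U')"
    by blast
  have 0: "cube_center B (L, U) \<bullet> i = 0" if "i \<in> L'" for i
    using c that by (simp add: cube_face_def)
  have 1: "cube_center B (L, U) \<bullet> i = 1" if "i \<in> U'" for i
    using c that by (simp add: cube_face_def)
  have iB: "i \<in> B \<and> i \<in> Basis" if "i \<in> L' \<or> i \<in> U'" for i
    using that assms by (auto simp: sign_pairs_def)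
  have "i \<in> L" if "i \<in> L'" for i
    using 0[OF that] iB[of i] that by (simp add: inner_cube_center[OF assms(1)] split: if_splits)
  moreover have "i \<in> U" if "i \<in> U'" for i
    using 1[OF that] iB[of i] that by (simp add: inner_cube_center[OF assms(1)] split: if_splits)
  ultimately show "L' \<subseteq> L \<and> U' \<subseteq> U"
    by blast
qed (auto simp: cube_face_def)

text \<open>\<open>L\<close> and \<open>U\<close> are read off from a relatively interior point
  \<open>x\<close> of \<open>G\<close>. A segment from any \<open>y\<close> in the encoded face to
  \<open>x\<close> can be prolonged beyond \<open>x\<close> inside the cube, so the face property
  puts \<open>y\<close> into \<open>G\<close>.\<close>

lemma cube_faces_surj:
  assumes B: "B \<subseteq> Basis" and G: "G face_of unit_cube B" "G \<noteq> {}"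
  shows "\<exists>s\<in>sign_pairs B. G = cube_face B s"
proof -
  have "convex G"
    using G face_of_imp_convex by blast
  then obtain x where x: "x \<in> rel_interior G"
    using G rel_interior_eq_empty by blast
  then have "x \<in> G"
    using rel_interior_subset by blast
  then have xc: "x \<in> unit_cube B"
    using G face_of_imp_subset by blast
  define L where "L = {i\<in>B. x \<bullet> i = 0}"
  define U where "U = {i\<in>B. x \<bullet> i = 1}"
  have s: "(L, U) \<in> sign_pairs B"
    by (auto simp: L_def U_def sign_pairs_def)
  have "x \<in> cube_face B (L, U)"
    using xc by (auto simp: cube_face_def L_def U_def)
  then have "G \<subseteq> cube_face B (L, U)"
    using subset_of_face_of[OF cube_face_face_of[OF B s] face_of_imp_subset[OF G(1)]] x
       \<open>x \<in> cube_face B (L, U)\<close> by blast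
  moreover have "y \<in> G" if y: "y \<in> cube_face B (L, U)" for y
  proof (cases "y = x")
    case False
    \<comment> \<open>The least distance of a free coordinate of \<open>x\<close> from 0 and 1.
      Coordinates of \<open>y\<close> and \<open>x\<close> differ by at most 1, so moving by
      \<epsilon> times the difference stays in the cube; the inserted 1 covers the case without free
      coordinates.\<close>
    define \<epsilon> where "\<epsilon> = Min (insert 1 ((\<lambda>i. min (x \<bullet> i) (1 - x \<bullet> i)) ` (B - L - U)))"
    have "finite B"
      using B finite_Basis finite_subset by metis
    have pos: "0 < \<epsilon>"
    proof -
      have "0 < min (x \<bullet> i) (1 - x \<bullet> i)" if "i \<in> B - L - U" for i
        using xc that by (auto simp: mem_unit_cube[OF B] L_def U_def less_le)
      then show ?thesis
        unfolding \<epsilon>_def using \<open>finite B\<close> by (subst Min_gr_iff) auto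
    qed
    have le: "\<epsilon> \<le> x \<bullet> i" "\<epsilon> \<le> 1 - x \<bullet> i" if "i \<in> B - L - U" for i
    proof -
      have "\<epsilon> \<le> min (x \<bullet> i) (1 - x \<bullet> i)"
        unfolding \<epsilon>_def using that \<open>finite B\<close> by (intro Min_le) auto
      then show "\<epsilon> \<le> x \<bullet> i" "\<epsilon> \<le> 1 - x \<bullet> i" by auto
    qed
    define z where "z = x - \<epsilon> *\<^sub>R (y - x)"
    have yc: "y \<in> unit_cube B"
      using y by (auto simp: cube_face_def)
    have "z \<in> unit_cube B"
      unfolding mem_unit_cube[OF B]
    proof (intro conjI ballI)
      fix i assume i: "i \<in> B"
      have zi: "z \<bullet> i = x \<bullet> i - \<epsilon> * (y \<bullet> i - x \<bullet> i)"
        by (simp add: z_def inner_simps)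
      show "0 \<le> z \<bullet> i" "z \<bullet> i \<le> 1"
      proof -
        consider "i \<in> L" | "i \<in> U" | "i \<in> B - L - U"
          using i by blast
        then have "0 \<le> z \<bullet> i \<and> z \<bullet> i \<le> 1"
        proof cases
          case 1
          with y show ?thesis
            by (simp add: zi cube_face_def L_def)
        next
          case 2
          with y show ?thesis
            by (simp add: zi cube_face_def U_def)
        next
          case 3
          have "\<bar>y \<bullet> i - x \<bullet> i\<bar> \<le> 1"
            using xc yc i by (simp add: mem_unit_cube[OF B] abs_le_iff) (smt (verit))
          then have "\<bar>\<epsilon> * (y \<bullet> i - x \<bullet> i)\<bar> \<le> \<epsilon>"
            using pos by (simp add: abs_mult mult_left_le)
          with le[OF 3] show ?thesis
            unfolding zi by linarith
        qed
        then show "0 \<le> z \<bullet> i" "z \<bullet> i \<le> 1" by auto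
      qed
    next
      fix i assume "i \<in> Basis - B"
      then show "z \<bullet> i = 0"
        using xc yc by (simp add: z_def inner_simps mem_unit_cube[OF B])
    qed
    moreover have "x \<in> open_segment y z"
    proof -
      \<comment> \<open>The solution of
        \<open>x = (1 - t) *\<^sub>R y + t *\<^sub>R z\<close>.\<close>
      define t where "t = 1 / (1 + \<epsilon>)"
      have "x = (1 - t) *\<^sub>R y + t *\<^sub>R z"
      proof -
        have "(1 - t) *\<^sub>R y + t *\<^sub>R z = (1 - t - t * \<epsilon>) *\<^sub>R y + (t + t * \<epsilon>) *\<^sub>R x"
          by (simp add: z_def algebra_simps)
        moreover have "t + t * \<epsilon> = 1"
          using pos by (simp add: t_def field_simps)
        ultimately show ?thesis by simp
      qed
      moreover have "0 < t" "t < 1"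
        using pos by (auto simp: t_def)
      moreover have "y \<noteq> z"
      proof
        assume "y = z"
        then have "(1 + \<epsilon>) *\<^sub>R (y - x) = 0"
          by (simp add: z_def algebra_simps)
        with pos False show False by simp
      qed
      ultimately show ?thesis
        by (auto simp: in_segment)
    qed
    ultimately show ?thesis
      using face_ofD[OF G(1)] yc \<open>x \<in> G\<close> by blast
  qed (use \<open>x \<in> G\<close> in simp)
  ultimately show ?thesis
    using s by blast
qed

lemma aff_dim_unit_cube:
  assumes "B \<subseteq> Basis"
  shows "aff_dim (unit_cube B) = int (card B)"
proof -
  have "0 \<in> unit_cube B"
    using assms by (simp add: mem_unit_cube)
  then have "aff_dim (unit_cube B) = int (dim (unit_cube B))"
    using aff_dim_zero[OF hull_inc] by blast
  also have "dim (unit_cube B) = dim B"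
  proof (rule span_eq_dim, rule span_eq[THEN iffD2, rule_format], intro conjI subsetI)
    fix x assume "x \<in> unit_cube B"
    then have "(\<Sum>i\<in>B. (x \<bullet> i) *\<^sub>R i) = (\<Sum>i\<in>Basis. (x \<bullet> i) *\<^sub>R i)"
      using assms by (intro sum.mono_neutral_left) (auto simp: mem_unit_cube)
    then have "x = (\<Sum>i\<in>B. (x \<bullet> i) *\<^sub>R i)"
      by (simp add: euclidean_representation)
    also have "\<dots> \<in> span B"
      by (intro span_sum span_scale span_base)
    finally show "x \<in> span B" .
  next
    fix i assume "i \<in> B"
    then have "i \<in> unit_cube B"
      using assms by (auto simp: mem_unit_cube inner_Basis subset_eq)
    then show "i \<in> span (unit_cube B)"
      by (rule span_base)
  qed
  also have "dim B = card B"
    using assms by (intro dim_eq_card_independent independent_mono[OF independent_Basis])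
  finally show ?thesis .
qed

text \<open>The face is the unit cube on the free directions, shifted by
  \<open>\<Sum>U\<close>.\<close>

lemma aff_dim_cube_face:
  assumes "B \<subseteq> Basis" "(L, U) \<in> sign_pairs B"
  shows "aff_dim (cube_face B (L, U)) = int (card B) - int (card L) - int (card U)"
proof -
  have fin: "finite B" "finite L" "finite U"
    using assms finite_subset[OF _ finite_Basis] by (auto simp: sign_pairs_def intro: finite_subset)
  have sub: "L \<subseteq> B" "U \<subseteq> B" "L \<inter> U = {}" "U \<subseteq> Basis"
    using assms by (auto simp: sign_pairs_def)
  have inU: "\<Sum>U \<bullet> i = (if i \<in> U then 1 else 0)" if "i \<in> Basis" for i
  proof -
    have "\<Sum>U \<bullet> i = (\<Sum>b\<in>U. if b = i then 1 else 0)"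
      unfolding inner_sum_left using sub that by (intro sum.cong) (auto simp: inner_Basis)
    then show ?thesis
      using fin by simp
  qed
  have "cube_face B (L, U) = (+) (\<Sum>U) ` unit_cube (B - L - U)"
  proof (intro subset_antisym subsetI)
    fix x assume x: "x \<in> cube_face B (L, U)"
    then have "x - \<Sum>U \<in> unit_cube (B - L - U)"
      using assms(1) sub by (auto simp: cube_face_def mem_unit_cube inner_simps inU subset_eq)
    then show "x \<in> (+) (\<Sum>U) ` unit_cube (B - L - U)"
      by (metis add_diff_cancel_left' diff_add_cancel image_iff add.commute)
  next
    fix x assume "x \<in> (+) (\<Sum>U) ` unit_cube (B - L - U)"
    then obtain y where y: "x = \<Sum>U + y" "y \<in> unit_cube (B - L - U)"
      by blast
    have BLU: "B - L - U \<subseteq> Basis"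
      using assms by blast
    have y0: "y \<bullet> i = 0" if "i \<in> Basis" "i \<in> L \<union> U \<union> (Basis - B)" for i
      using y(2) that mem_unit_cube[OF BLU] by auto
    moreover have "0 \<le> y \<bullet> i \<and> y \<bullet> i \<le> 1" if "i \<in> Basis" for i
      using y(2) that mem_unit_cube[OF BLU] y0[of i] by (cases "i \<in> B - L - U") auto
    ultimately show "x \<in> cube_face B (L, U)"
      using assms(1) sub unfolding cube_face_def mem_unit_cube[OF assms(1)] y(1) prod.case mem_Collect_eq
      by (auto simp: inner_simps inU subset_eq)
  qed
  moreover have "B - L - U \<subseteq> Basis"
    using assms by blast
  ultimately have "aff_dim (cube_face B (L, U)) = int (card (B - L - U))"
    by (simp add: aff_dim_translation_eq aff_dim_unit_cube)
  also have "B - L - U = B - (L \<union> U)"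
    by blast
  also have "int (card (B - (L \<union> U))) = int (card B) - int (card (L \<union> U))"
    using fin sub by (simp add: card_Diff_subset card_mono of_nat_diff)
  also have "card (L \<union> U) = card L + card U"
    using fin sub by (simp add: card_Un_disjoint)
  finally show ?thesis by simp
qed

section \<open>Coordinates on the faces of a combinatorial cube\<close>

text \<open>All that is kept of an isomorphism with a cube. The empty face has no sign pair and is
  left out; inclusion is reversed because smaller faces fix more coordinates.\<close>

locale cube_coords =
  fixes B :: "'b set" and f :: "'b set \<times> 'b set \<Rightarrow> 'a::euclidean_space set" and F :: "'a set"
  assumes fin: "finite B"
    and convex: "convex F"
    and bij: "bij_betw f (sign_pairs B) {G. G face_of F \<and> G \<noteq> {}}"
    and dim: "(L, U) \<in> sign_pairs B \<Longrightarrow> aff_dim (f (L, U)) = int (card B) - int (card L) - int (card U)"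
    and order: "(L, U) \<in> sign_pairs B \<Longrightarrow> (L', U') \<in> sign_pairs B \<Longrightarrow>
      f (L, U) \<subseteq> f (L', U') \<longleftrightarrow> L' \<subseteq> L \<and> U' \<subseteq> U"

lemma combinatorial_cube_coords:
  fixes F :: "'a::euclidean_space set"
  assumes "combinatorial_cube k F" and "polytope F"
  shows "\<exists>(B :: 'a set) f. cube_coords B f F \<and> card B = k"
proof -
  obtain B :: "'a set" and \<phi> where B: "B \<subseteq> Basis" "card B = k"
    and \<phi>: "bij_betw \<phi> {F'. F' face_of F} {G. G face_of unit_cube B}"
    and iff: "\<And>G G'. G face_of F \<Longrightarrow> G' face_of F \<Longrightarrow> G \<subseteq> G' \<longleftrightarrow> \<phi> G \<subseteq> \<phi> G'"
    using assms unfolding combinatorial_cube_def combinatorially_equivalent_def by blast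
  have polyB: "polytope (unit_cube B)"
    by (simp add: unit_cube_def polytope_interval)
  have dim\<phi>: "aff_dim (\<phi> G) = aff_dim G" if "G face_of F" for G
    using iso_faces_aff_dim_eq[OF assms(2) polyB \<phi> iff that] .
  define \<psi> where "\<psi> = inv_into {F'. F' face_of F} \<phi>"
  have \<psi>: "bij_betw \<psi> {G. G face_of unit_cube B} {F'. F' face_of F}"
    unfolding \<psi>_def using \<phi> by (rule bij_betw_inv_into)
  have face: "\<psi> G face_of F" and inv: "\<phi> (\<psi> G) = G" if "G face_of unit_cube B" for G
    using \<psi> \<phi> that by (auto simp: \<psi>_def bij_betw_inv_into_right dest: bij_betwE)
  have inv': "\<psi> (\<phi> G) = G" and face': "\<phi> G face_of unit_cube B" if "G face_of F" for G
    using \<phi> that by (auto simp: \<psi>_def bij_betw_inv_into_left dest: bij_betwE)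
  \<comment> \<open>The isomorphism preserves dimension, and only the empty face has dimension
    -1.\<close>
  have empty: "\<psi> G = {} \<longleftrightarrow> G = {}" if "G face_of unit_cube B" for G
    using dim\<phi>[OF face[OF that]] inv[OF that] by (metis aff_dim_empty)
  have "bij_betw \<psi> {G. G face_of unit_cube B \<and> G \<noteq> {}} {G. G face_of F \<and> G \<noteq> {}}"
  proof (rule bij_betw_byWitness[where f' = \<phi>])
    show "\<phi> ` {G. G face_of F \<and> G \<noteq> {}} \<subseteq> {G. G face_of unit_cube B \<and> G \<noteq> {}}"
    proof clarify
      fix G assume G: "G face_of F" "G \<noteq> {}"
      then show "\<phi> G face_of unit_cube B \<and> \<phi> G \<noteq> {}"
        using face'[of G] inv'[of G] empty[of "\<phi> G"] by simp
    qed
    show "\<psi> ` {G. G face_of unit_cube B \<and> G \<noteq> {}} \<subseteq> {G. G face_of F \<and> G \<noteq> {}}"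
      using face empty by blast
  qed (use inv inv' in auto)
  moreover have "bij_betw (cube_face B) (sign_pairs B) {G. G face_of unit_cube B \<and> G \<noteq> {}}"
    unfolding bij_betw_def
  proof
    show "inj_on (cube_face B) (sign_pairs B)"
    proof (rule inj_onI, clarify)
      fix L U L' U'
      assume s: "(L, U) \<in> sign_pairs B" "(L', U') \<in> sign_pairs B"
        and eq: "cube_face B (L, U) = cube_face B (L', U')"
      from eq show "L = L' \<and> U = U'"
        using cube_face_subset_iff[OF B(1) s] cube_face_subset_iff[OF B(1) s(2) s(1)] by blast
    qed
    show "cube_face B ` sign_pairs B = {G. G face_of unit_cube B \<and> G \<noteq> {}}"
    proof
      show "cube_face B ` sign_pairs B \<subseteq> {G. G face_of unit_cube B \<and> G \<noteq> {}}"
        using cube_face_face_of[OF B(1)] cube_center_in_face[OF B(1)] by blast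
      show "{G. G face_of unit_cube B \<and> G \<noteq> {}} \<subseteq> cube_face B ` sign_pairs B"
        using cube_faces_surj[OF B(1)] by blast
    qed
  qed
  ultimately have bij: "bij_betw (\<psi> \<circ> cube_face B) (sign_pairs B) {G. G face_of F \<and> G \<noteq> {}}"
    by (rule bij_betw_trans[rotated])
  have "cube_coords B (\<psi> \<circ> cube_face B) F"
  proof
    show "finite B"
      using B finite_Basis finite_subset by metis
    show "convex F"
      using assms polytope_imp_convex by blast
    show "aff_dim ((\<psi> \<circ> cube_face B) (L, U)) = int (card B) - int (card L) - int (card U)"
      if s: "(L, U) \<in> sign_pairs B" for L U
    proof -
      have "cube_face B (L, U) face_of unit_cube B"
        by (rule cube_face_face_of[OF B(1) s])
      then show ?thesis
        using dim\<phi>[of "\<psi> (cube_face B (L, U))"] face inv aff_dim_cube_face[OF B(1) s] by simp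
    qed
    show "(\<psi> \<circ> cube_face B) (L, U) \<subseteq> (\<psi> \<circ> cube_face B) (L', U') \<longleftrightarrow> L' \<subseteq> L \<and> U' \<subseteq> U"
      if s: "(L, U) \<in> sign_pairs B" "(L', U') \<in> sign_pairs B" for L U L' U'
    proof -
      have "cube_face B (L, U) face_of unit_cube B" "cube_face B (L', U') face_of unit_cube B"
        using s cube_face_face_of[OF B(1)] by auto
      then show ?thesis
        using iff[of "\<psi> (cube_face B (L, U))" "\<psi> (cube_face B (L', U'))"] face inv
          cube_face_subset_iff[OF B(1) s] by simp
    qed
  qed (rule bij)
  with B(2) show ?thesis by blast
qed

section \<open>Generating functions of cube faces\<close>

lemma sum_sign_pairs:
  assumes "finite B"
  shows "(\<Sum>(L, U)\<in>{(L, U) \<in> sign_pairs B. L \<subseteq> X \<and> U \<subseteq> Y}. monom (1::int) (card B - card L - card U))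
    = (\<Prod>i\<in>B. [:of_bool (i \<in> X) + of_bool (i \<in> Y), 1:])"
  using assms
proof (induction B rule: finite_induct)
  case empty
  have "{(L, U) \<in> sign_pairs {}. L \<subseteq> X \<and> U \<subseteq> Y} = {({}, {})}"
    by (auto simp: sign_pairs_def)
  then show ?case by simp
next
  case (insert i B)
  define S where "S = {(L, U) \<in> sign_pairs B. L \<subseteq> X \<and> U \<subseteq> Y}"
  define S1 where "S1 = (if i \<in> X then (\<lambda>(L, U). (insert i L, U)) ` S else {})"
  define S2 where "S2 = (if i \<in> Y then (\<lambda>(L, U). (L, insert i U)) ` S else {})"
  define g where "g = (\<lambda>(L :: 'a set, U :: 'a set). monom (1::int) (card (insert i B) - card L - card U))"
  define h where "h = (\<lambda>(L :: 'a set, U :: 'a set). monom (1::int) (card B - card L - card U))"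
  \<comment> \<open>The last bound keeps the natural subtraction in the exponents exact.\<close>
  have SB: "L \<subseteq> B" "U \<subseteq> B" "finite L" "finite U" "i \<notin> L" "i \<notin> U" "card L + card U \<le> card B"
    if "(L, U) \<in> S" for L U
  proof -
    show sub: "L \<subseteq> B" "U \<subseteq> B" and fin: "finite L" "finite U" and "i \<notin> L" "i \<notin> U"
      using that insert by (auto simp: S_def sign_pairs_def intro: finite_subset)
    have "card L + card U = card (L \<union> U)"
      using that fin by (simp add: S_def sign_pairs_def card_Un_disjoint)
    also have "\<dots> \<le> card B"
      using sub insert by (intro card_mono) auto
    finally show "card L + card U \<le> card B" .
  qed
  have "S \<subseteq> Pow B \<times> Pow B"
    by (auto simp: S_def sign_pairs_def)
  then have finS: "finite S"
    using insert.hyps(1) finite_subset by (metis finite_Pow_iff finite_SigmaI)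
  \<comment> \<open>The three parts have the direction \<open>i\<close> free, fixed at the lower end
    and fixed at the upper end.\<close>
  have eq: "{(L, U) \<in> sign_pairs (insert i B). L \<subseteq> X \<and> U \<subseteq> Y} = S \<union> (S1 \<union> S2)"
  proof (intro subset_antisym subsetI)
    fix s assume "s \<in> {(L, U) \<in> sign_pairs (insert i B). L \<subseteq> X \<and> U \<subseteq> Y}"
    then obtain L U where s: "s = (L, U)" "L \<subseteq> insert i B" "U \<subseteq> insert i B" "L \<inter> U = {}" "L \<subseteq> X" "U \<subseteq> Y"
      by (auto simp: sign_pairs_def)
    consider "i \<in> L" "i \<notin> U" | "i \<in> U" "i \<notin> L" | "i \<notin> L" "i \<notin> U"
      using s by blast
    then show "s \<in> S \<union> (S1 \<union> S2)"
    proof cases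
      case 1
      then have "(L - {i}, U) \<in> S" "s = (insert i (L - {i}), U)" "i \<in> X"
        using s by (auto simp: S_def sign_pairs_def)
      then show ?thesis
        unfolding S1_def by force
    next
      case 2
      then have "(L, U - {i}) \<in> S" "s = (L, insert i (U - {i}))" "i \<in> Y"
        using s by (auto simp: S_def sign_pairs_def)
      then show ?thesis
        unfolding S2_def by force
    next
      case 3
      then show ?thesis
        using s by (auto simp: S_def sign_pairs_def)
    qed
  next
    fix s assume "s \<in> S \<union> (S1 \<union> S2)"
    then show "s \<in> {(L, U) \<in> sign_pairs (insert i B). L \<subseteq> X \<and> U \<subseteq> Y}"
      using insert.hyps(2) by (auto simp: S_def S1_def S2_def sign_pairs_def split: if_splits)
  qed
  have disj: "S \<inter> (S1 \<union> S2) = {}" "S1 \<inter> S2 = {}"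
    using SB(5,6) by (fastforce simp: S1_def S2_def split: if_splits)+
  have fin12: "finite S1" "finite S2"
    using finS by (auto simp: S1_def S2_def)
  have "(\<Sum>s\<in>S \<union> (S1 \<union> S2). g s) = sum g S + (sum g S1 + sum g S2)"
    using finS fin12 disj by (simp add: sum.union_disjoint)
  moreover have "sum g S = [:0, 1:] * sum h S"
    unfolding sum_distrib_left
  proof (rule sum.cong[OF refl], clarify)
    fix L U assume s: "(L, U) \<in> S"
    have "card (insert i B) - card L - card U = Suc (card B - card L - card U)"
      using SB(7)[OF s] insert.hyps by simp
    then show "g (L, U) = [:0, 1:] * h (L, U)"
      by (simp add: g_def h_def monom_Suc)
  qed
  moreover have "sum g S1 = (if i \<in> X then sum h S else 0)"
  proof -
    have "inj_on (\<lambda>(L, U). (insert i L, U)) S"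
      by (rule inj_onI) (use SB(5,6) in \<open>force simp: insert_ident\<close>)
    moreover have "g (insert i L, U) = h (L, U)" if "(L, U) \<in> S" for L U
      using SB[OF that] insert.hyps by (simp add: g_def h_def)
    ultimately show ?thesis
      by (auto simp: S1_def sum.reindex intro!: sum.cong)
  qed
  moreover have "sum g S2 = (if i \<in> Y then sum h S else 0)"
  proof -
    have "inj_on (\<lambda>(L, U). (L, insert i U)) S"
      by (rule inj_onI) (use SB(5,6) in \<open>force simp: insert_ident\<close>)
    moreover have "g (L, insert i U) = h (L, U)" if "(L, U) \<in> S" for L U
      using SB[OF that] insert.hyps by (simp add: g_def h_def)
    ultimately show ?thesis
      by (auto simp: S2_def sum.reindex intro!: sum.cong)
  qed
  moreover have "smult 2 (sum h S) = sum h S + sum h S"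
    by (metis one_add_one smult_1_left smult_add_left)
  ultimately have "(\<Sum>s\<in>S \<union> (S1 \<union> S2). g s) = [:of_bool (i \<in> X) + of_bool (i \<in> Y), 1:] * sum h S"
    by (simp add: add_ac)
  also have "sum h S = (\<Prod>i\<in>B. [:of_bool (i \<in> X) + of_bool (i \<in> Y), 1:])"
    unfolding S_def h_def by (rule insert.IH)
  finally show ?case
    using insert.hyps by (simp add: eq g_def del: mult_pCons_left)
qed

lemma prod_eq_box_poly:
  assumes "finite B" "X \<subseteq> B" "Y \<subseteq> B"
  shows "(\<Prod>i\<in>B. [:of_bool (i \<in> X) + of_bool (i \<in> Y), 1:])
    = box_poly (card (B - X - Y)) (card ((X - Y) \<union> (Y - X))) (card (X \<inter> Y))"
proof -
  let ?g = "\<lambda>i. [:of_bool (i \<in> X) + of_bool (i \<in> Y), 1:] :: int poly"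
  have fin: "finite X" "finite Y"
    using assms finite_subset by metis+
  have "B = (B - X - Y) \<union> ((X - Y) \<union> (Y - X)) \<union> (X \<inter> Y)"
    using assms by blast
  then have "prod ?g B = prod ?g ((B - X - Y) \<union> ((X - Y) \<union> (Y - X)) \<union> (X \<inter> Y))"
    by (rule arg_cong)
  also have "\<dots> = prod ?g ((B - X - Y) \<union> ((X - Y) \<union> (Y - X))) * prod ?g (X \<inter> Y)"
    using assms fin by (intro prod.union_disjoint) auto
  also have "prod ?g ((B - X - Y) \<union> ((X - Y) \<union> (Y - X)))
      = prod ?g (B - X - Y) * prod ?g ((X - Y) \<union> (Y - X))"
    using assms fin by (intro prod.union_disjoint) auto
  also have "prod ?g (B - X - Y) = (\<Prod>i\<in>B - X - Y. [:0, 1:])"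
    by (intro prod.cong) auto
  also have "prod ?g ((X - Y) \<union> (Y - X)) = (\<Prod>i\<in>(X - Y) \<union> (Y - X). [:1, 1:])"
    by (intro prod.cong) auto
  also have "prod ?g (X \<inter> Y) = (\<Prod>i\<in>X \<inter> Y. [:2, 1:])"
    by (intro prod.cong) auto
  finally show ?thesis
    by (simp add: box_poly_def)
qed

context cube_coords
begin

lemma pair_facet:
  assumes "i \<in> B"
  shows "({i}, {}) \<in> sign_pairs B" "({}, {i}) \<in> sign_pairs B"
  using assms by (auto simp: sign_pairs_def)

lemma faceE:
  assumes "G face_of F" "G \<noteq> {}"
  obtains L U where "(L, U) \<in> sign_pairs B" "G = f (L, U)"
proof -
  have "G \<in> f ` sign_pairs B"
    using assms bij by (simp add: bij_betw_def)
  then show thesis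
    using that by (auto simp: image_iff)
qed

lemma f_top: "f ({}, {}) = F"
proof -
  have top: "({}, {}) \<in> sign_pairs B"
    by (auto simp: sign_pairs_def)
  then have face: "f ({}, {}) face_of F" "f ({}, {}) \<noteq> {}"
    using bij by (auto dest: bij_betwE)
  then have "f ({}, {}) \<subseteq> F"
    using face_of_imp_subset by blast
  with face have "F face_of F" "F \<noteq> {}"
    using convex by (auto simp: face_of_refl)
  then obtain L U where "(L, U) \<in> sign_pairs B" "F = f (L, U)"
    by (rule faceE)
  then have "F \<subseteq> f ({}, {})"
    using order top by simp
  with \<open>f ({}, {}) \<subseteq> F\<close> show ?thesis by blast
qed

lemma aff_dim_F: "aff_dim F = int (card B)"
  using dim[of "{}" "{}"] f_top by (simp add: sign_pairs_def)

lemma f_face: "s \<in> sign_pairs B \<Longrightarrow> f s face_of F \<and> f s \<noteq> {}"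
  using bij by (auto dest: bij_betwE)

lemma facets_eq: "{G. G facet_of F} = (\<lambda>i. f ({i}, {})) ` B \<union> (\<lambda>i. f ({}, {i})) ` B"
proof (intro subset_antisym subsetI)
  fix G assume "G \<in> {G. G facet_of F}"
  then have G: "G face_of F" "G \<noteq> {}" "aff_dim G = int (card B) - 1"
    using aff_dim_F by (auto simp: facet_of_def)
  from G(1,2) obtain L U where LU: "(L, U) \<in> sign_pairs B" "G = f (L, U)"
    by (rule faceE)
  then have "card L + card U = 1"
    using G dim by simp
  then consider "card L = 1" "card U = 0" | "card L = 0" "card U = 1"
    by linarith
  moreover have fin': "finite L" "finite U" "L \<subseteq> B" "U \<subseteq> B"
    using LU fin by (auto simp: sign_pairs_def intro: finite_subset)
  ultimately show "G \<in> (\<lambda>i. f ({i}, {})) ` B \<union> (\<lambda>i. f ({}, {i})) ` B"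
    using LU by cases (auto simp: card_1_singleton_iff)
next
  fix G assume "G \<in> (\<lambda>i. f ({i}, {})) ` B \<union> (\<lambda>i. f ({}, {i})) ` B"
  then show "G \<in> {G. G facet_of F}"
    using pair_facet f_face dim aff_dim_F by (auto simp: facet_of_def)
qed

text \<open>\<open>f (L, U)\<close> lies in the facet \<open>f ({i}, {})\<close> iff
  \<open>i\<close> is in \<open>L\<close>, and likewise for \<open>U\<close>; avoiding
  \<open>R\<close> thus restricts \<open>L\<close> to \<open>X\<close> and \<open>U\<close> to
  \<open>Y\<close>. The first argument of \<open>box_poly\<close> counts the directions with both
  facets in \<open>R\<close>.\<close>

lemma count_faces_avoiding:
  assumes R: "R \<subseteq> {G. G facet_of F}"
    and X: "X = {i \<in> B. f ({i}, {}) \<notin> R}" and Y: "Y = {i \<in> B. f ({}, {i}) \<notin> R}"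
  shows "int (card {G. G face_of F \<and> aff_dim G = int j \<and> (\<forall>\<rho>\<in>R. \<not> G \<subseteq> \<rho>)})
    = coeff (box_poly (card (B - X - Y)) (card ((X - Y) \<union> (Y - X))) (card (X \<inter> Y))) j"
proof -
  let ?S = "{(L, U) \<in> sign_pairs B. L \<subseteq> X \<and> U \<subseteq> Y}"
  let ?S' = "{(L, U) \<in> sign_pairs B. L \<subseteq> X \<and> U \<subseteq> Y \<and> card B - card L - card U = j}"
  have avoid: "(\<forall>\<rho>\<in>R. \<not> f (L, U) \<subseteq> \<rho>) \<longleftrightarrow> L \<subseteq> X \<and> U \<subseteq> Y" if s: "(L, U) \<in> sign_pairs B" for L U
  proof -
    have "f (L, U) \<subseteq> f ({i}, {}) \<longleftrightarrow> i \<in> L" "f (L, U) \<subseteq> f ({}, {i}) \<longleftrightarrow> i \<in> U" if "i \<in> B" for i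
      using order[OF s pair_facet(1)[OF that]] order[OF s pair_facet(2)[OF that]] by auto
    moreover have "(\<forall>\<rho>\<in>R. \<not> f (L, U) \<subseteq> \<rho>) \<longleftrightarrow>
       (\<forall>i\<in>B. f ({i}, {}) \<in> R \<longrightarrow> \<not> f (L, U) \<subseteq> f ({i}, {})) \<and>
       (\<forall>i\<in>B. f ({}, {i}) \<in> R \<longrightarrow> \<not> f (L, U) \<subseteq> f ({}, {i}))"
      using R unfolding facets_eq by blast
    ultimately have "(\<forall>\<rho>\<in>R. \<not> f (L, U) \<subseteq> \<rho>) \<longleftrightarrow>
       (\<forall>i\<in>B. f ({i}, {}) \<in> R \<longrightarrow> i \<notin> L) \<and> (\<forall>i\<in>B. f ({}, {i}) \<in> R \<longrightarrow> i \<notin> U)"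
      by simp
    moreover have "L \<subseteq> B" "U \<subseteq> B"
      using s by (auto simp: sign_pairs_def)
    moreover have "L \<subseteq> X \<longleftrightarrow> L \<subseteq> B \<and> (\<forall>i\<in>B. f ({i}, {}) \<in> R \<longrightarrow> i \<notin> L)"
      "U \<subseteq> Y \<longleftrightarrow> U \<subseteq> B \<and> (\<forall>i\<in>B. f ({}, {i}) \<in> R \<longrightarrow> i \<notin> U)"
      by (auto simp: X Y)
    ultimately show ?thesis
      by simp
  qed
  have dim': "aff_dim (f (L, U)) = int j \<longleftrightarrow> card B - card L - card U = j" if s: "(L, U) \<in> sign_pairs B" for L U
  proof -
    have "card L + card U = card (L \<union> U)"
      using s fin by (auto simp: sign_pairs_def card_Un_disjoint finite_subset)
    also have "\<dots> \<le> card B"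
      using s fin by (intro card_mono) (auto simp: sign_pairs_def)
    finally show ?thesis
      using dim[OF s] by linarith
  qed
  have "{G. G face_of F \<and> aff_dim G = int j \<and> (\<forall>\<rho>\<in>R. \<not> G \<subseteq> \<rho>)} = f ` ?S'"
  proof (intro subset_antisym subsetI)
    fix G assume G: "G \<in> {G. G face_of F \<and> aff_dim G = int j \<and> (\<forall>\<rho>\<in>R. \<not> G \<subseteq> \<rho>)}"
    then have "G \<noteq> {}" by auto
    moreover have "G face_of F"
      using G by simp
    ultimately obtain L U where LU: "(L, U) \<in> sign_pairs B" "G = f (L, U)"
      by (elim faceE)
    then have "(L, U) \<in> ?S'"
      using G avoid[OF LU(1)] dim'[OF LU(1)] by simp
    then show "G \<in> f ` ?S'"
      using LU by blast
  next
    fix G assume "G \<in> f ` ?S'"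
    then obtain L U where "(L, U) \<in> ?S'" "G = f (L, U)" by force
    then show "G \<in> {G. G face_of F \<and> aff_dim G = int j \<and> (\<forall>\<rho>\<in>R. \<not> G \<subseteq> \<rho>)}"
      using f_face avoid dim' by auto
  qed
  moreover have "inj_on f ?S'"
    using bij by (auto simp: bij_betw_def intro: inj_on_subset)
  ultimately have card: "card {G. G face_of F \<and> aff_dim G = int j \<and> (\<forall>\<rho>\<in>R. \<not> G \<subseteq> \<rho>)} = card ?S'"
    by (simp add: card_image)
  have "?S \<subseteq> Pow B \<times> Pow B"
    by (auto simp: sign_pairs_def)
  then have finS: "finite ?S"
    using fin finite_subset by (metis (no_types, lifting) finite_Pow_iff finite_SigmaI)
  have "coeff (\<Sum>(L, U)\<in>?S. monom (1::int) (card B - card L - card U)) j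
      = (\<Sum>(L, U)\<in>?S. if card B - card L - card U = j then 1 else 0)"
    unfolding coeff_sum by (intro sum.cong) (auto simp: coeff_monom)
  also have "\<dots> = (\<Sum>s\<in>?S. if (\<lambda>(L, U). card B - card L - card U = j) s then 1 else 0)"
    by (intro sum.cong) auto
  also have "\<dots> = (\<Sum>s\<in>{s\<in>?S. (\<lambda>(L, U). card B - card L - card U = j) s}. 1)"
    using finS by (rule sum.inter_filter[symmetric])
  also have "{s\<in>?S. (\<lambda>(L, U). card B - card L - card U = j) s} = ?S'"
    by auto
  finally have "int (card ?S') = coeff (\<Sum>(L, U)\<in>?S. monom (1::int) (card B - card L - card U)) j"
    by simp
  also have "\<dots> = coeff (\<Prod>i\<in>B. [:of_bool (i \<in> X) + of_bool (i \<in> Y), 1:]) j"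
    by (simp only: sum_sign_pairs[OF fin])
  also have "\<dots> = coeff (box_poly (card (B - X - Y)) (card ((X - Y) \<union> (Y - X))) (card (X \<inter> Y))) j"
    using fin X Y by (subst prod_eq_box_poly) auto
  finally show ?thesis
    unfolding card .
qed

text \<open>At a vertex every coordinate is fixed, and freeing one of them gives an edge. A proper
  face through the vertex fixes some \<open>i\<close> and so cannot contain the edge that frees
  \<open>i\<close>; \<open>cubical_vertex_degree\<close> uses this to find an edge outside another
  facet.\<close>

lemma vertex_edges:
  assumes "v face_of F" "aff_dim v = 0"
  obtains E where "inj_on E B" "\<And>i. i \<in> B \<Longrightarrow> E i face_of F \<and> aff_dim (E i) = 1 \<and> v \<subseteq> E i"
    "\<And>H. H face_of F \<Longrightarrow> H \<noteq> F \<Longrightarrow> v \<subseteq> H \<Longrightarrow> \<exists>i\<in>B. \<not> E i \<subseteq> H"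
proof -
  have "v \<noteq> {}" using assms by auto
  with assms(1) obtain L U where LU: "(L, U) \<in> sign_pairs B" "v = f (L, U)"
    by (elim faceE)
  have finLU: "finite L" "finite U" "L \<subseteq> B" "U \<subseteq> B" "L \<inter> U = {}"
    using LU fin by (auto simp: sign_pairs_def intro: finite_subset)
  have cardLU: "card L + card U = card B"
    using dim[OF LU(1)] LU assms by simp
  then have "card (L \<union> U) = card B"
    using finLU by (simp add: card_Un_disjoint)
  then have B: "L \<union> U = B"
    using fin finLU by (intro card_subset_eq) auto
  define E where "E = (\<lambda>i. f (L - {i}, U - {i}))"
  have pair: "(L - {i}, U - {i}) \<in> sign_pairs B" for i
    using LU by (auto simp: sign_pairs_def)
  have sub: "E i \<subseteq> f (L', U') \<longleftrightarrow> L' \<subseteq> L - {i} \<and> U' \<subseteq> U - {i}" if "(L', U') \<in> sign_pairs B" for i L' U'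
    unfolding E_def using order[OF pair that] .
  show thesis
  proof
    show "inj_on E B"
    proof (rule inj_onI)
      fix i j assume ij: "i \<in> B" "j \<in> B" "E i = E j"
      then have "L - {j} \<subseteq> L - {i}" "U - {j} \<subseteq> U - {i}"
        using sub[OF pair, of i j] by (auto simp: E_def)
      then show "i = j"
        using ij B by blast
    qed
    show "E i face_of F \<and> aff_dim (E i) = 1 \<and> v \<subseteq> E i" if "i \<in> B" for i
    proof (intro conjI)
      show "E i face_of F"
        using f_face[OF pair] by (auto simp: E_def)
      show "v \<subseteq> E i"
        unfolding E_def LU(2) using order[OF LU(1) pair] by blast
      have "int (card (L - {i})) + int (card (U - {i})) = int (card B) - 1"
      proof (cases "i \<in> L")
        case True
        then have "i \<notin> U" using finLU by blast
        have "card L > 0"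
          using True finLU card_gt_0_iff by blast
        then show ?thesis
          using True \<open>i \<notin> U\<close> finLU cardLU by (simp add: of_nat_diff)
      next
        case False
        then have "i \<in> U" using that B by blast
        have "card U > 0"
          using \<open>i \<in> U\<close> finLU card_gt_0_iff by blast
        then show ?thesis
          using False \<open>i \<in> U\<close> finLU cardLU by (simp add: of_nat_diff)
      qed
      then show "aff_dim (E i) = 1"
        unfolding E_def dim[OF pair] by linarith
    qed
    show "\<exists>i\<in>B. \<not> E i \<subseteq> H" if H: "H face_of F" "H \<noteq> F" "v \<subseteq> H" for H
    proof -
      have "H \<noteq> {}"
        using H \<open>v \<noteq> {}\<close> by blast
      with H(1) obtain L' U' where H': "(L', U') \<in> sign_pairs B" "H = f (L', U')"
        by (elim faceE)
      have "L' \<noteq> {} \<or> U' \<noteq> {}"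
        using H H' f_top by auto
      then obtain i where i: "i \<in> L' \<union> U'" by blast
      then have "i \<in> B"
        using H' by (auto simp: sign_pairs_def)
      moreover have "\<not> E i \<subseteq> H"
        using sub[OF H'(1), of i] i H' by auto
      ultimately show ?thesis by blast
    qed
  qed
qed

end

text \<open>Complementing \<open>R\<close> among the facets complements \<open>X\<close> and
  \<open>Y\<close> in \<open>B\<close>, which exchanges the directions in both sets with those in
  neither.\<close>

lemma cube_faces_count:
  assumes "combinatorial_cube k F" and "polytope F" and "R \<subseteq> {\<rho>. \<rho> facet_of F}"
  obtains a b c where "a + b + c = k"
    and "\<And>j. int (card {G. G face_of F \<and> aff_dim G = int j \<and> (\<forall>\<rho>\<in>R. \<not> G \<subseteq> \<rho>)}) = coeff (box_poly a b c) j"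
    and "\<And>j. int (card {G. G face_of F \<and> aff_dim G = int j \<and> (\<forall>\<rho>\<in>{\<rho>. \<rho> facet_of F} - R. \<not> G \<subseteq> \<rho>)})
       = coeff (box_poly c b a) j"
proof -
  obtain B :: "'a set" and f where "cube_coords B f F" and k: "card B = k"
    using combinatorial_cube_coords[OF assms(1,2)] by blast
  then interpret cube_coords B f F by simp
  define X where "X = {i \<in> B. f ({i}, {}) \<notin> R}"
  define Y where "Y = {i \<in> B. f ({}, {i}) \<notin> R}"
  have X': "B - X = {i \<in> B. f ({i}, {}) \<notin> {\<rho>. \<rho> facet_of F} - R}"
    and Y': "B - Y = {i \<in> B. f ({}, {i}) \<notin> {\<rho>. \<rho> facet_of F} - R}"
    unfolding X_def Y_def facets_eq by auto
  have XY: "X \<subseteq> B" "Y \<subseteq> B"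
    by (auto simp: X_def Y_def)
  have finXY: "finite X" "finite Y"
    using XY fin finite_subset by metis+
  show thesis
  proof
    have "card B = card ((B - X - Y) \<union> ((X - Y) \<union> (Y - X)) \<union> (X \<inter> Y))"
      using XY by (intro arg_cong[where f = card]) blast
    also have "\<dots> = card ((B - X - Y) \<union> ((X - Y) \<union> (Y - X))) + card (X \<inter> Y)"
      using fin finXY by (intro card_Un_disjoint) auto
    also have "card ((B - X - Y) \<union> ((X - Y) \<union> (Y - X))) = card (B - X - Y) + card ((X - Y) \<union> (Y - X))"
      using fin finXY by (intro card_Un_disjoint) auto
    finally show "card (B - X - Y) + card ((X - Y) \<union> (Y - X)) + card (X \<inter> Y) = k"
      using k by simp
    show "int (card {G. G face_of F \<and> aff_dim G = int j \<and> (\<forall>\<rho>\<in>R. \<not> G \<subseteq> \<rho>)})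
        = coeff (box_poly (card (B - X - Y)) (card ((X - Y) \<union> (Y - X))) (card (X \<inter> Y))) j" for j
      using count_faces_avoiding[OF assms(3) X_def Y_def] .
    have "B - (B - X) - (B - Y) = X \<inter> Y" "((B - X) - (B - Y)) \<union> ((B - Y) - (B - X)) = (X - Y) \<union> (Y - X)"
      "(B - X) \<inter> (B - Y) = B - X - Y"
      using XY by blast+
    then show "int (card {G. G face_of F \<and> aff_dim G = int j \<and> (\<forall>\<rho>\<in>{\<rho>. \<rho> facet_of F} - R. \<not> G \<subseteq> \<rho>)})
        = coeff (box_poly (card (X \<inter> Y)) (card ((X - Y) \<union> (Y - X))) (card (B - X - Y))) j" for j
      using count_faces_avoiding[OF _ X' Y', of j] by simp
  qed
qed

section \<open>Generic orders on the facets of a polytope\<close>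

text \<open>A vector that works for \<open>Z\<close> is perturbed along the new \<open>z\<close>;
  each hyperplane excludes at most one multiple of \<open>z\<close>.\<close>

lemma finite_avoid_hyperplanes:
  fixes Z :: "'a::real_inner set"
  assumes "finite Z" "subspace V" "Z \<subseteq> V" "0 \<notin> Z"
  shows "\<exists>c\<in>V. \<forall>z\<in>Z. z \<bullet> c \<noteq> 0"
  using assms(1,3,4)
proof (induction Z rule: finite_induct)
  case empty
  then show ?case
    using subspace_0[OF assms(2)] by blast
next
  case (insert z Z)
  then obtain c where c: "c \<in> V" "\<forall>w\<in>Z. w \<bullet> c \<noteq> 0"
    by auto
  \<comment> \<open>For \<open>w\<close> not orthogonal to \<open>z\<close>, the one parameter at
    which \<open>w\<close> becomes orthogonal to the perturbed vector. If \<open>w\<close> is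
    orthogonal to \<open>z\<close>, the perturbation leaves its product with \<open>c\<close>
    unchanged.\<close>
  define bad where "bad = (\<lambda>w. - (w \<bullet> c) / (w \<bullet> z)) ` insert z Z"
  have "finite bad"
    using insert by (simp add: bad_def)
  then obtain t where t: "t \<notin> insert 0 bad"
    using ex_new_if_finite[OF infinite_UNIV_char_0, of "insert 0 bad"] by auto
  have "w \<bullet> (c + t *\<^sub>R z) \<noteq> 0" if w: "w \<in> insert z Z" for w
  proof (cases "w \<bullet> z = 0")
    case True
    then have "w \<noteq> z"
      using insert.prems by auto
    then have "w \<bullet> c \<noteq> 0"
      using c w by blast
    with True show ?thesis
      by (simp add: inner_simps)
  next
    case False
    show ?thesis
    proof
      assume "w \<bullet> (c + t *\<^sub>R z) = 0"
      then have "t = - (w \<bullet> c) / (w \<bullet> z)"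
        using False by (simp add: inner_simps field_simps eq_neg_iff_add_eq_0)
      with t w show False
        by (auto simp: bad_def)
    qed
  qed
  moreover have "c + t *\<^sub>R z \<in> V"
    using c insert.prems assms(2) by (intro subspace_add subspace_scale) auto
  ultimately show ?case by blast
qed

section \<open>Facet normals and ridges\<close>

lemma facet_of_subset_eq:
  assumes "\<sigma> facet_of P" "\<tau> facet_of P" "\<sigma> \<subseteq> \<tau>"
  shows "\<sigma> = \<tau>"
proof (rule ccontr)
  assume "\<sigma> \<noteq> \<tau>"
  have "\<sigma> face_of \<tau>"
    using assms face_of_subset[of \<sigma> P \<tau>] facet_of_imp_face_of face_of_imp_subset by metis
  then have "aff_dim \<sigma> < aff_dim \<tau>"
    using face_of_aff_dim_lt[of \<tau> \<sigma>] \<open>\<sigma> \<noteq> \<tau>\<close> assms facet_of_imp_face_of face_of_imp_convex by metis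
  with assms show False
    by (simp add: facet_of_def)
qed

text \<open>
  With the relatively interior point \<open>p\<close> as origin, every facet has an equation
  \<open>y \<bullet> (x - p) = 1\<close>; the vectors \<open>y\<close> are the vertices of the polar polytope.
\<close>
locale pointed_polytope =
  fixes P :: "'a::euclidean_space set" and p :: 'a
  assumes polytope: "polytope P" and p: "p \<in> rel_interior P"
begin

text \<open>The direction space of the affine hull. Taking normals inside it lets the arguments on
  ridges work for a polytope that is not full-dimensional.\<close>

definition dirs :: "'a set" where
  "dirs = {v. p + v \<in> affine hull P}"

lemma p_in_P: "p \<in> P"
  using p rel_interior_subset by blast

lemma subspace_dirs: "subspace dirs"
proof -
  have "dirs = (\<lambda>x. - p + x) ` (affine hull P)"
    by (force simp: dirs_def image_iff)
  then show ?thesis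
    using affine_diffs_subspace[OF affine_affine_hull hull_inc[OF p_in_P]] by simp
qed

lemma diff_in_dirs: "x \<in> affine hull P \<Longrightarrow> x - p \<in> dirs"
  by (simp add: dirs_def)

lemma finite_facets: "finite {\<sigma>. \<sigma> facet_of P}"
  using polytope finite_polytope_facets by blast

lemma facet_not_p: "\<sigma> facet_of P \<Longrightarrow> p \<notin> \<sigma>"
  using face_of_disjoint_rel_interior[OF facet_of_imp_face_of] p facet_of_irrefl by fastforce

lemma ex_normal:
  assumes "\<sigma> facet_of P"
  shows "\<exists>y\<in>dirs. (\<forall>x\<in>P. y \<bullet> (x - p) \<le> 1) \<and> \<sigma> = {x \<in> P. y \<bullet> (x - p) = 1}"
proof -
  have "\<sigma> exposed_face_of P"
    using assms polytope polytope_imp_polyhedron exposed_face_of_polyhedron facet_of_imp_face_of by metis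
  moreover have "\<sigma> \<noteq> P"
    using assms by auto
  ultimately obtain a b where ab: "P \<subseteq> {x. a \<bullet> x \<le> b}" "\<sigma> = P \<inter> {x. a \<bullet> x = b}"
    "\<forall>w\<in>affine hull P. w + a \<in> affine hull P"
    unfolding exposed_face_of_parallel by blast
  have "a \<bullet> p < b"
    using ab facet_not_p[OF assms] p_in_P by fastforce
  \<comment> \<open>The rescaling that turns \<open>a \<bullet> x <= b\<close> into an inequality
    with right-hand side 1; \<open>p\<close> satisfies the former strictly.\<close>
  define y where "y = (1 / (b - a \<bullet> p)) *\<^sub>R a"
  have "a \<in> dirs"
    using ab(3) hull_inc[OF p_in_P] by (auto simp: dirs_def)
  then have "y \<in> dirs"
    unfolding y_def by (rule subspace_scale[OF subspace_dirs])
  have inner_y: "y \<bullet> (x - p) = (a \<bullet> x - a \<bullet> p) / (b - a \<bullet> p)" for x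
    by (simp add: y_def inner_diff_right diff_divide_distrib)
  have "y \<bullet> (x - p) \<le> 1 \<longleftrightarrow> a \<bullet> x \<le> b" "y \<bullet> (x - p) = 1 \<longleftrightarrow> a \<bullet> x = b" for x
    using \<open>a \<bullet> p < b\<close> by (auto simp: inner_y)
  with \<open>y \<in> dirs\<close> show ?thesis
    using ab(1,2) by (intro bexI[of _ y]) auto
qed

definition normal :: "'a set \<Rightarrow> 'a" where
  "normal \<sigma> = (SOME y. y \<in> dirs \<and> (\<forall>x\<in>P. y \<bullet> (x - p) \<le> 1) \<and> \<sigma> = {x \<in> P. y \<bullet> (x - p) = 1})"

lemma normal:
  assumes "\<sigma> facet_of P"
  shows "normal \<sigma> \<in> dirs" "x \<in> P \<Longrightarrow> normal \<sigma> \<bullet> (x - p) \<le> 1"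
    "x \<in> \<sigma> \<longleftrightarrow> x \<in> P \<and> normal \<sigma> \<bullet> (x - p) = 1"
proof -
  have "\<exists>y. y \<in> dirs \<and> (\<forall>x\<in>P. y \<bullet> (x - p) \<le> 1) \<and> \<sigma> = {x \<in> P. y \<bullet> (x - p) = 1}"
    using ex_normal[OF assms] by (simp add: Bex_def)
  note * = someI_ex[OF this, folded normal_def]
  show "normal \<sigma> \<in> dirs" "x \<in> P \<Longrightarrow> normal \<sigma> \<bullet> (x - p) \<le> 1"
    using * by simp_all
  have "x \<in> \<sigma> \<longleftrightarrow> x \<in> {x \<in> P. normal \<sigma> \<bullet> (x - p) = 1}"
    using * by metis
  then show "x \<in> \<sigma> \<longleftrightarrow> x \<in> P \<and> normal \<sigma> \<bullet> (x - p) = 1"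
    by simp
qed

lemma normal_inj: "inj_on normal {\<sigma>. \<sigma> facet_of P}"
proof (rule inj_onI)
  fix \<sigma> \<tau> assume "\<sigma> \<in> {\<sigma>. \<sigma> facet_of P}" "\<tau> \<in> {\<sigma>. \<sigma> facet_of P}" "normal \<sigma> = normal \<tau>"
  then have "x \<in> \<sigma> \<longleftrightarrow> x \<in> \<tau>" for x
    using normal(3)[of \<sigma> x] normal(3)[of \<tau> x] by simp
  then show "\<sigma> = \<tau>" by blast
qed

lemma affine_level: "affine {x \<in> affine hull P. y \<bullet> (x - p) = r}"
proof -
  have "{x \<in> affine hull P. y \<bullet> (x - p) = r} = affine hull P \<inter> {x. y \<bullet> x = r + y \<bullet> p}"
    by (auto simp: inner_diff_right)
  then show ?thesis
    by (metis affine_Int affine_affine_hull affine_hyperplane)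
qed

text \<open>The right-hand side omits \<open>p\<close>, so its dimension is below that of
  \<open>P\<close>. If it were strictly larger than the hull of the facet, there would be a
  dimension strictly between those of facet and polytope.\<close>

lemma affine_hull_facet:
  assumes "\<sigma> facet_of P"
  shows "affine hull \<sigma> = {x \<in> affine hull P. normal \<sigma> \<bullet> (x - p) = 1}"
proof (rule ccontr)
  let ?W = "{x \<in> affine hull P. normal \<sigma> \<bullet> (x - p) = 1}"
  assume neq: "affine hull \<sigma> \<noteq> ?W"
  have W: "affine hull ?W = ?W"
    by (rule affine_hull_eq[THEN iffD2, OF affine_level])
  have "\<sigma> \<subseteq> ?W"
    using normal(3)[OF assms] hull_inc[of _ P affine] by blast
  then have "affine hull \<sigma> \<subset> affine hull ?W"
    using neq hull_mono[of \<sigma> ?W affine] unfolding W by blast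
  then have "aff_dim \<sigma> < aff_dim ?W"
    by (rule aff_dim_psubset)
  moreover have "aff_dim ?W < aff_dim P"
  proof (rule aff_dim_psubset)
    have "p \<notin> ?W" by simp
    then show "affine hull ?W \<subset> affine hull P"
      unfolding W using hull_inc[OF p_in_P, of affine] by blast
  qed
  ultimately show False
    using assms by (simp add: facet_of_def)
qed

text \<open>Vertices of the polar are extreme: on \<open>\<sigma>\<close> a mean of two values at
  most 1 equals 1, so both do, which places \<open>\<sigma>\<close> inside
  \<open>\<tau>1\<close>.\<close>

lemma facet_normal_convex_comb:
  assumes "\<sigma> facet_of P" "\<tau>1 facet_of P" "\<tau>2 facet_of P" "0 < l" "l < 1"
    and "normal \<sigma> = (1 - l) *\<^sub>R normal \<tau>1 + l *\<^sub>R normal \<tau>2"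
  shows "\<sigma> = \<tau>1"
proof (rule facet_of_subset_eq[OF assms(1,2)], rule subsetI)
  fix x assume "x \<in> \<sigma>"
  then have x: "x \<in> P" "normal \<sigma> \<bullet> (x - p) = 1"
    using normal(3)[OF assms(1)] by auto
  then have "(1 - l) * (normal \<tau>1 \<bullet> (x - p)) + l * (normal \<tau>2 \<bullet> (x - p)) = 1"
    unfolding assms(6) by (simp add: inner_add_left)
  then have "normal \<tau>1 \<bullet> (x - p) = 1"
    using convex_bounds_eq[OF assms(4,5)] normal(2)[OF assms(2) x(1)] normal(2)[OF assms(3) x(1)] by blast
  then show "x \<in> \<tau>1"
    using normal(3)[OF assms(2)] x by blast
qed

text \<open>A proper nonempty face is the intersection of the facets containing it; with \<sigma>
  alone the ridge would equal \<sigma>.\<close>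

lemma ridge_in_other_facet:
  assumes "\<sigma> facet_of P" "\<rho> facet_of \<sigma>"
  shows "\<exists>\<tau>. \<tau> facet_of P \<and> \<tau> \<noteq> \<sigma> \<and> \<rho> \<subseteq> \<tau>"
proof (rule ccontr)
  assume no: "\<not> ?thesis"
  have "\<rho> face_of P" "\<rho> \<noteq> {}"
    using assms by (auto simp: facet_of_def intro: face_of_trans)
  moreover have "\<rho> \<subseteq> \<sigma>"
    using assms facet_of_imp_subset by blast
  moreover have "\<rho> \<noteq> P"
    using assms by (auto simp: facet_of_def)
  ultimately have "\<rho> = \<Inter>{\<tau>. \<tau> facet_of P \<and> \<rho> \<subseteq> \<tau>}"
    using face_of_polyhedron polytope polytope_imp_polyhedron by blast
  also have "{\<tau>. \<tau> facet_of P \<and> \<rho> \<subseteq> \<tau>} = {\<sigma>}"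
    using no assms \<open>\<rho> \<subseteq> \<sigma>\<close> by blast
  finally show False
    using assms by simp
qed

text \<open>
  The normals of the facets through a ridge lie on a line, and of three facets the one whose normal
  is in the middle would be contained in the other two.
\<close>
lemma ridge_in_two_facets:
  assumes "\<sigma> facet_of P" "\<rho> facet_of \<sigma>"
    and "\<tau>1 facet_of P" "\<rho> \<subseteq> \<tau>1" "\<tau>1 \<noteq> \<sigma>"
    and "\<tau>2 facet_of P" "\<rho> \<subseteq> \<tau>2" "\<tau>2 \<noteq> \<sigma>"
  shows "\<tau>1 = \<tau>2"
proof (rule ccontr)
  assume "\<tau>1 \<noteq> \<tau>2"
  define z where "z = normal \<tau>1 - normal \<sigma>"
  define w where "w = normal \<tau>2 - normal \<sigma>"
  have "z \<noteq> 0" "w \<noteq> 0" "z \<noteq> w"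
    using normal_inj assms \<open>\<tau>1 \<noteq> \<tau>2\<close> by (auto simp: z_def w_def inj_on_def)
  have dirs: "z \<in> dirs" "w \<in> dirs"
    unfolding z_def w_def using normal(1) assms by (auto intro: subspace_diff[OF subspace_dirs])
  have \<rho>P: "\<rho> \<subseteq> P" "\<rho> \<subseteq> \<sigma>"
    using assms facet_of_imp_subset by blast+
  have \<rho>1: "normal \<tau> \<bullet> (x - p) = 1" if "x \<in> \<rho>" "\<tau> \<in> {\<sigma>, \<tau>1, \<tau>2}" for x \<tau>
    using that assms normal(3) \<rho>P by blast
  have perp: "z \<bullet> (x - p) = 0" "w \<bullet> (x - p) = 0" if "x \<in> insert p \<rho>" for x
    using that \<rho>1 by (auto simp: z_def w_def inner_diff_left)
  \<comment> \<open>A hyperplane of the affine hull containing \<open>p\<close> and the ridge. These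
    have the dimension of a hyperplane together, so they span it.\<close>
  let ?W = "{x \<in> affine hull P. z \<bullet> (x - p) = 0}"
  have W: "affine hull ?W = ?W"
    by (rule affine_hull_eq[THEN iffD2, OF affine_level])
  have "p + z \<in> affine hull P"
    using dirs by (simp add: dirs_def)
  moreover have "p + z \<notin> ?W"
    using \<open>z \<noteq> 0\<close> by simp
  ultimately have "affine hull ?W \<subset> affine hull P"
    unfolding W by blast
  then have "aff_dim ?W < aff_dim P"
    by (rule aff_dim_psubset)
  moreover have "p \<notin> affine hull \<rho>"
  proof -
    have "affine hull \<rho> \<subseteq> affine hull \<sigma>"
      using \<rho>P by (intro hull_mono)
    then show ?thesis
      using affine_hull_facet[OF assms(1)] by auto
  qed
  then have "aff_dim (insert p \<rho>) = aff_dim P - 1"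
    using assms by (simp add: aff_dim_insert facet_of_def)
  moreover have sub: "insert p \<rho> \<subseteq> ?W"
    using perp \<rho>P hull_inc[of _ P affine] p_in_P by blast
  ultimately have "\<not> affine hull (insert p \<rho>) \<subset> affine hull ?W"
    using aff_dim_psubset[of "insert p \<rho>" ?W] by linarith
  then have H: "affine hull (insert p \<rho>) = ?W"
    using hull_mono[OF sub, of affine] W by auto
  \<comment> \<open>The component of \<open>w\<close> orthogonal to \<open>z\<close> is a direction
    of \<open>?W\<close>, but it is also orthogonal to all of \<open>?W\<close>; hence it vanishes
    and the three normals are collinear.\<close>
  define l where "l = (w \<bullet> z) / (z \<bullet> z)"
  define w' where "w' = w - l *\<^sub>R z"
  have "w' \<in> dirs"
    unfolding w'_def using dirs by (intro subspace_diff subspace_scale subspace_dirs)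
  moreover have "z \<bullet> w' = 0"
    using \<open>z \<noteq> 0\<close> by (simp add: w'_def l_def inner_simps inner_commute)
  ultimately have "p + w' \<in> affine hull (insert p \<rho>)"
    unfolding H by (simp add: dirs_def)
  moreover have "insert p \<rho> \<subseteq> {x \<in> affine hull P. w' \<bullet> (x - p) = 0}"
    using sub perp by (auto simp: w'_def inner_diff_left)
  then have "affine hull (insert p \<rho>) \<subseteq> {x \<in> affine hull P. w' \<bullet> (x - p) = 0}"
    by (rule hull_minimal) (rule affine_level)
  ultimately have "w' \<bullet> w' = 0"
    by auto
  then have w: "w = l *\<^sub>R z"
    by (simp add: w'_def)
  then have "l \<noteq> 0" "l \<noteq> 1"
    using \<open>w \<noteq> 0\<close> \<open>z \<noteq> w\<close> by auto
  \<comment> \<open>On the line, \<sigma>, \<tau>1 and \<tau>2 sit at 0, 1 and \<open>l\<close>; the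
    cases tell which of them is in the middle.\<close>
  then consider "0 < l" "l < 1" | "l > 1" | "l < 0"
    by linarith
  then show False
  proof cases
    case 1
    have "normal \<tau>2 = (1 - l) *\<^sub>R normal \<sigma> + l *\<^sub>R normal \<tau>1"
      using w by (simp add: z_def w_def algebra_simps)
    then have "\<tau>2 = \<sigma>"
      using 1 assms by (intro facet_normal_convex_comb[of \<tau>2 \<sigma> \<tau>1 l])
    with assms show False by simp
  next
    case 2
    have "z = (1 / l) *\<^sub>R w"
      using w 2 by simp
    then have "normal \<tau>1 = (1 - 1 / l) *\<^sub>R normal \<sigma> + (1 / l) *\<^sub>R normal \<tau>2"
      by (simp add: z_def w_def algebra_simps)
    then have "\<tau>1 = \<sigma>"
      using 2 assms by (intro facet_normal_convex_comb[of \<tau>1 \<sigma> \<tau>2 "1 / l"]) auto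
    with assms show False by simp
  next
    case 3
    \<comment> \<open>The position of the normal of \<sigma> on the segment from \<tau>2 to
      \<tau>1.\<close>
    define m where "m = - l / (1 - l)"
    have m: "0 < m" "m < 1"
      using 3 by (auto simp: m_def field_simps)
    have "(1 - l) *\<^sub>R normal \<sigma> = normal \<tau>2 - l *\<^sub>R normal \<tau>1"
      using w by (simp add: z_def w_def algebra_simps)
    then have "(1 / (1 - l)) *\<^sub>R ((1 - l) *\<^sub>R normal \<sigma>) = (1 / (1 - l)) *\<^sub>R (normal \<tau>2 - l *\<^sub>R normal \<tau>1)"
      by simp
    moreover have "1 - m = 1 / (1 - l)"
      using 3 by (simp add: m_def field_simps)
    ultimately have "normal \<sigma> = (1 - m) *\<^sub>R normal \<tau>2 + m *\<^sub>R normal \<tau>1"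
      using 3 by (simp add: m_def scaleR_diff_right)
    then have "\<sigma> = \<tau>2"
      using m assms by (intro facet_normal_convex_comb[of \<sigma> \<tau>2 \<tau>1 m]) auto
    with assms show False by simp
  qed
qed

text \<open>Otherwise the intersection would be a face strictly between the ridge and \<sigma>,
  whose dimensions differ by one.\<close>

lemma ridge_eq_Int:
  assumes "\<sigma> facet_of P" "\<rho> facet_of \<sigma>" "\<tau> facet_of P" "\<rho> \<subseteq> \<tau>" "\<tau> \<noteq> \<sigma>"
  shows "\<sigma> \<inter> \<tau> = \<rho>"
proof (rule ccontr)
  assume neq: "\<sigma> \<inter> \<tau> \<noteq> \<rho>"
  have faces: "\<sigma> face_of P" "\<tau> face_of P" "\<rho> face_of \<sigma>"
    using assms facet_of_imp_face_of by blast+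
  have "\<sigma> \<inter> \<tau> face_of P"
    using faces face_of_Int by blast
  then have face: "\<sigma> \<inter> \<tau> face_of \<sigma>"
    using face_of_subset[of "\<sigma> \<inter> \<tau>" P \<sigma>] faces face_of_imp_subset by blast
  have "\<sigma> \<inter> \<tau> \<noteq> \<sigma>"
    using facet_of_subset_eq[of \<sigma> P \<tau>] assms by blast
  then have "aff_dim (\<sigma> \<inter> \<tau>) < aff_dim \<sigma>"
    using face_of_aff_dim_lt[OF _ face] faces face_of_imp_convex by blast
  moreover have "\<rho> \<subseteq> \<sigma> \<inter> \<tau>"
    using face_of_imp_subset[OF faces(3)] assms(4) by simp
  then have "\<rho> face_of \<sigma> \<inter> \<tau>"
    using face_of_subset[OF faces(3)] by simp
  then have "aff_dim \<rho> < aff_dim (\<sigma> \<inter> \<tau>)"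
    using face_of_aff_dim_lt[of "\<sigma> \<inter> \<tau>" \<rho>] neq face face_of_imp_convex by blast
  ultimately show False
    using assms by (simp add: facet_of_def)
qed

text \<open>
  Dually: on a face of the polar polytope, a vertex that does not minimise a linear functional has
  a neighbour with a smaller value. The proof leaves \<open>\<sigma>\<close> from a point of \<open>G\<close> in the direction
  \<open>-c'\<close>, where \<open>c'\<close> is \<open>c\<close> shifted to be parallel to \<open>\<sigma>\<close>: this violates the inequality of \<open>\<tau>\<close>,
  hence leaves \<open>\<sigma>\<close> across a ridge, and the facet behind this ridge is lower.
\<close>
lemma lower_facet_across_ridge:
  assumes \<sigma>: "\<sigma> facet_of P" and \<tau>: "\<tau> facet_of P" and G: "G face_of P" "G \<noteq> {}" "G \<subseteq> \<sigma>" "G \<subseteq> \<tau>"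
    and "c \<in> dirs" and less: "normal \<tau> \<bullet> c < normal \<sigma> \<bullet> c"
  shows "\<exists>\<rho> \<tau>'. \<rho> facet_of \<sigma> \<and> G \<subseteq> \<rho> \<and> \<tau>' facet_of P \<and> \<rho> \<subseteq> \<tau>' \<and> normal \<tau>' \<bullet> c < normal \<sigma> \<bullet> c"
proof -
  have "convex G"
    using G face_of_imp_convex by blast
  then obtain x where x: "x \<in> rel_interior G"
    using G rel_interior_eq_empty by blast
  then have xG: "x \<in> G"
    using rel_interior_subset by blast
  then have xP: "x \<in> P"
    using G face_of_imp_subset by blast
  have poly\<sigma>: "polytope \<sigma>"
    using \<sigma> polytope face_of_polytope_polytope facet_of_imp_face_of by blast
  have "convex \<sigma>" "\<sigma> \<noteq> {}"
    using \<sigma> polytope_imp_convex[OF poly\<sigma>] by (auto simp: facet_of_def)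
  then obtain q where q: "q \<in> rel_interior \<sigma>"
    using rel_interior_eq_empty by blast
  have q\<sigma>: "q \<in> \<sigma>"
    using q rel_interior_subset by blast
  have qP: "q \<in> P"
    using q\<sigma> \<sigma> facet_of_imp_subset by blast
  \<comment> \<open>Facets through \<open>x\<close> have value 1 at \<open>x\<close>, so for them
    the product of the normal with \<open>c'\<close> is the difference of their value and that of
    \<sigma>, and it is 0 for \<sigma> itself.\<close>
  define c' where "c' = c - (normal \<sigma> \<bullet> c) *\<^sub>R (x - p)"
  have "c' \<in> dirs"
    unfolding c'_def
    by (rule subspace_diff[OF subspace_dirs assms(7) subspace_scale[OF subspace_dirs diff_in_dirs[OF hull_inc[OF xP]]]])
  have c': "normal \<kappa> \<bullet> c' = normal \<kappa> \<bullet> c - normal \<sigma> \<bullet> c" if "\<kappa> facet_of P" "x \<in> \<kappa>" for \<kappa>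
    using normal(3)[OF that(1), of x] that by (simp add: c'_def inner_simps)
  define z where "z = (\<lambda>\<epsilon>. x - \<epsilon> *\<^sub>R c')"
  have inner_z: "y \<bullet> (z \<epsilon> - p) = y \<bullet> (x - p) - \<epsilon> * (y \<bullet> c')" for y \<epsilon>
    by (simp add: z_def inner_simps)
  define other where "other = (\<lambda>\<rho>. SOME \<tau>'. \<tau>' facet_of P \<and> \<tau>' \<noteq> \<sigma> \<and> \<rho> \<subseteq> \<tau>')"
  have other: "other \<rho> facet_of P" "other \<rho> \<noteq> \<sigma>" "\<rho> \<subseteq> other \<rho>" if "\<rho> facet_of \<sigma>" for \<rho>
    using someI_ex[OF ridge_in_other_facet[OF \<sigma> that]] by (auto simp: other_def)
  have Int: "\<sigma> \<inter> other \<rho> = \<rho>" if "\<rho> facet_of \<sigma>" for \<rho>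
    using ridge_eq_Int[OF \<sigma> that other(1)[OF that] other(3)[OF that] other(2)[OF that]] .
  \<comment> \<open>For ridges that miss \<open>x\<close>, the facet behind has a strict inequality
    at \<open>x\<close>, which survives a small step. So the step can only cross inequalities of
    facets behind ridges through \<open>x\<close>.\<close>
  let ?N = "{\<rho>. \<rho> facet_of \<sigma> \<and> x \<notin> \<rho>}"
  have "\<forall>\<^sub>F \<epsilon> in at_right 0. \<forall>\<rho>\<in>?N. normal (other \<rho>) \<bullet> (z \<epsilon> - p) < 1"
  proof (rule eventually_ball_finite)
    show "finite ?N"
      using finite_polytope_facets[OF poly\<sigma>] by (rule rev_finite_subset) blast
    show "\<forall>\<rho>\<in>?N. \<forall>\<^sub>F \<epsilon> in at_right 0. normal (other \<rho>) \<bullet> (z \<epsilon> - p) < 1"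
    proof
      fix \<rho> assume "\<rho> \<in> ?N"
      then have \<rho>: "\<rho> facet_of \<sigma>" "x \<notin> \<rho>" by auto
      have "x \<notin> other \<rho>"
        using Int[OF \<rho>(1)] \<rho> xG G by blast
      then have "normal (other \<rho>) \<bullet> (x - p) < 1"
        using normal(2,3)[OF other(1)[OF \<rho>(1)], of x] xP by simp
      moreover have "((\<lambda>\<epsilon>. normal (other \<rho>) \<bullet> (z \<epsilon> - p)) \<longlongrightarrow> normal (other \<rho>) \<bullet> (x - p) - 0 * (normal (other \<rho>) \<bullet> c')) (at_right 0)"
        unfolding inner_z by (intro tendsto_intros)
      ultimately show "\<forall>\<^sub>F \<epsilon> in at_right 0. normal (other \<rho>) \<bullet> (z \<epsilon> - p) < 1"
        by (intro order_tendstoD(2)) auto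
    qed
  qed
  moreover have "\<forall>\<^sub>F \<epsilon> in at_right (0::real). 0 < \<epsilon>"
    by (rule eventually_at_right_less)
  ultimately have "\<forall>\<^sub>F \<epsilon> in at_right 0. (\<forall>\<rho>\<in>?N. normal (other \<rho>) \<bullet> (z \<epsilon> - p) < 1) \<and> 0 < \<epsilon>"
    by (rule eventually_conj)
  then obtain \<epsilon> where \<epsilon>: "\<forall>\<rho>\<in>?N. normal (other \<rho>) \<bullet> (z \<epsilon> - p) < 1" "0 < \<epsilon>"
    using eventually_happens[of _ "at_right (0::real)"] trivial_limit_at_right_real[of "0::real"] by auto
  have "x + (- \<epsilon>) *\<^sub>R ((p + c') - p) \<in> affine hull P"
    using \<open>c' \<in> dirs\<close> hull_inc[OF xP] hull_inc[OF p_in_P]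
    by (intro mem_affine_3_minus[OF affine_affine_hull]) (auto simp: dirs_def)
  then have "z \<epsilon> \<in> affine hull P"
    by (simp add: z_def)
  moreover have "normal \<sigma> \<bullet> (z \<epsilon> - p) = 1"
    using c'[OF \<sigma>] G xG normal(3)[OF \<sigma>, of x] by (auto simp: inner_z)
  ultimately have z_hull: "z \<epsilon> \<in> affine hull \<sigma>"
    by (simp add: affine_hull_facet[OF \<sigma>])
  have "normal \<tau> \<bullet> (z \<epsilon> - p) > 1"
  proof -
    have "x \<in> \<tau>" using xG G by blast
    then have "normal \<tau> \<bullet> (x - p) = 1" "normal \<tau> \<bullet> c' < 0"
      using normal(3)[OF \<tau>, of x] c'[OF \<tau>] less by auto
    then show ?thesis
      using \<epsilon> by (simp add: inner_z mult_pos_neg)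
  qed
  then have zP: "z \<epsilon> \<notin> P"
    using normal(2)[OF \<tau>, of "z \<epsilon>"] by auto
  then have "z \<epsilon> \<noteq> q"
    using qP by auto
  have "q + (z \<epsilon> - q) \<in> affine hull \<sigma>" "z \<epsilon> - q \<noteq> 0"
    using z_hull \<open>z \<epsilon> \<noteq> q\<close> by auto
  \<comment> \<open>The ray from the interior point \<open>q\<close> to \<open>z \<epsilon>\<close>
    leaves \<sigma> at some \<open>u\<close> before reaching \<open>z \<epsilon>\<close>, since the
    latter is outside \<open>P\<close>.\<close>
  then obtain s where s: "0 < s" "q + s *\<^sub>R (z \<epsilon> - q) \<in> rel_frontier \<sigma>"
      "\<And>e. 0 \<le> e \<Longrightarrow> e < s \<Longrightarrow> q + e *\<^sub>R (z \<epsilon> - q) \<in> rel_interior \<sigma>"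
    using ray_to_rel_frontier[OF polytope_imp_bounded[OF poly\<sigma>] q] by metis
  define u where "u = q + s *\<^sub>R (z \<epsilon> - q)"
  obtain \<rho> where \<rho>: "\<rho> facet_of \<sigma>" "u \<in> \<rho>"
    using s(2) rel_frontier_of_polyhedron[OF polytope_imp_polyhedron[OF poly\<sigma>]] by (auto simp: u_def)
  have "u \<in> \<sigma>"
    using \<rho> facet_of_imp_subset by blast
  then have "u \<in> P"
    using \<sigma> facet_of_imp_subset by blast
  have "\<not> 1 < s"
  proof
    assume "1 < s"
    then have "z \<epsilon> \<in> rel_interior \<sigma>"
      using s(3)[of 1] by simp
    then have "z \<epsilon> \<in> P"
      using rel_interior_subset \<sigma> facet_of_imp_subset by blast
    with zP show False by simp
  qed
  moreover have "s \<noteq> 1"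
    using \<open>u \<in> P\<close> zP by (auto simp: u_def)
  ultimately have "s < 1" by simp
  let ?y = "normal (other \<rho>)"
  have yu: "?y \<bullet> (u - p) = 1"
    using normal(3)[OF other(1)[OF \<rho>(1)], of u] other(3)[OF \<rho>(1)] \<rho>(2) by blast
  have yq: "?y \<bullet> (q - p) < 1"
  proof -
    have "q \<notin> \<rho>"
      using face_of_disjoint_rel_interior[OF facet_of_imp_face_of[OF \<rho>(1)]] q \<rho>(1) facet_of_irrefl
      by blast
    then have "q \<notin> other \<rho>"
      using Int[OF \<rho>(1)] q\<sigma> by blast
    then show ?thesis
      using normal(2,3)[OF other(1)[OF \<rho>(1)], of q] qP by simp
  qed
  \<comment> \<open>The functional of the facet behind \<rho> is below 1 at \<open>q\<close> and 1
    at \<open>u\<close>, hence above 1 at \<open>z \<epsilon>\<close>; by the choice of \<epsilon>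
    the ridge contains \<open>x\<close>.\<close>
  have "u - p = (1 - s) *\<^sub>R (q - p) + s *\<^sub>R (z \<epsilon> - p)"
    by (simp add: u_def algebra_simps)
  then have "(1 - s) * (?y \<bullet> (q - p)) + s * (?y \<bullet> (z \<epsilon> - p)) = 1"
    using yu by (simp add: inner_add_right)
  moreover have "(1 - s) * (?y \<bullet> (q - p)) < (1 - s) * 1"
    using yq \<open>s < 1\<close> by (intro mult_strict_left_mono) auto
  ultimately have "s * 1 < s * (?y \<bullet> (z \<epsilon> - p))"
    by simp
  then have yz: "1 < ?y \<bullet> (z \<epsilon> - p)"
    using s(1) by (simp only: mult_less_cancel_left_pos)
  then have x\<rho>: "x \<in> \<rho>"
    using \<epsilon>(1) \<rho>(1) by force
  have "G \<subseteq> \<rho>"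
  proof (rule subset_of_face_of)
    show "\<rho> face_of P"
      using \<rho> \<sigma> facet_of_imp_face_of face_of_trans by blast
    show "G \<subseteq> P"
      using G face_of_imp_subset by blast
    show "\<rho> \<inter> rel_interior G \<noteq> {}"
      using x x\<rho> by blast
  qed
  moreover have "normal (other \<rho>) \<bullet> c < normal \<sigma> \<bullet> c"
  proof -
    have "x \<in> other \<rho>"
      using x\<rho> other(3)[OF \<rho>(1)] by blast
    then have "?y \<bullet> (x - p) = 1" and yc: "?y \<bullet> c' = ?y \<bullet> c - normal \<sigma> \<bullet> c"
      using normal(3)[OF other(1)[OF \<rho>(1)], of x] c'[OF other(1)[OF \<rho>(1)]] by auto
    then have "\<epsilon> * (?y \<bullet> c') < 0"
      using yz by (simp add: inner_z)
    then have "?y \<bullet> c' < 0"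
      using \<epsilon>(2) by (simp add: mult_less_0_iff)
    then show ?thesis
      using yc by simp
  qed
  ultimately show ?thesis
    using \<rho>(1) other[OF \<rho>(1)] by blast
qed

lemma ex_generic_direction:
  "\<exists>c\<in>dirs. inj_on (\<lambda>\<sigma>. normal \<sigma> \<bullet> c) {\<sigma>. \<sigma> facet_of P}"
proof -
  let ?\<Sigma> = "{\<sigma>. \<sigma> facet_of P}"
  define Z where "Z = (\<lambda>(\<sigma>, \<tau>). normal \<sigma> - normal \<tau>) ` (?\<Sigma> \<times> ?\<Sigma>) - {0}"
  have "finite Z"
    using finite_facets by (auto simp: Z_def)
  moreover have "Z \<subseteq> dirs"
    using normal(1) by (auto simp: Z_def intro: subspace_diff[OF subspace_dirs])
  ultimately obtain c where c: "c \<in> dirs" "\<forall>z\<in>Z. z \<bullet> c \<noteq> 0"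
    using finite_avoid_hyperplanes[OF _ subspace_dirs, of Z] by (auto simp: Z_def)
  have "inj_on (\<lambda>\<sigma>. normal \<sigma> \<bullet> c) ?\<Sigma>"
  proof (rule inj_onI, rule ccontr)
    fix \<sigma> \<tau> assume st: "\<sigma> \<in> ?\<Sigma>" "\<tau> \<in> ?\<Sigma>" "normal \<sigma> \<bullet> c = normal \<tau> \<bullet> c" "\<sigma> \<noteq> \<tau>"
    then have "normal \<sigma> - normal \<tau> \<noteq> 0"
      using normal_inj by (auto simp: inj_on_def)
    then have "normal \<sigma> - normal \<tau> \<in> Z"
      using st by (force simp: Z_def)
    with c st show False
      by (auto simp: inner_diff_left)
  qed
  with c show ?thesis by blast
qed

end

text \<open>A line shelling, reduced to what counting faces needs.\<close>
locale facet_order =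
  fixes P :: "'a::euclidean_space set" and val :: "'a set \<Rightarrow> real"
  assumes polytope: "polytope P"
    and inj_val: "inj_on val {\<sigma>. \<sigma> facet_of P}"
    and descent: "\<And>\<sigma> \<tau> G. \<sigma> facet_of P \<Longrightarrow> \<tau> facet_of P \<Longrightarrow> G face_of P \<Longrightarrow> G \<noteq> {} \<Longrightarrow>
      G \<subseteq> \<sigma> \<Longrightarrow> G \<subseteq> \<tau> \<Longrightarrow> val \<tau> < val \<sigma> \<Longrightarrow>
      \<exists>\<rho> \<tau>'. \<rho> facet_of \<sigma> \<and> G \<subseteq> \<rho> \<and> \<tau>' facet_of P \<and> \<rho> \<subseteq> \<tau>' \<and> val \<tau>' < val \<sigma>"
begin

definition lower_ridges :: "'a set \<Rightarrow> 'a set set" where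
  "lower_ridges \<sigma> = {\<rho>. \<rho> facet_of \<sigma> \<and> (\<exists>\<tau>. \<tau> facet_of P \<and> \<rho> \<subseteq> \<tau> \<and> val \<tau> < val \<sigma>)}"

definition new_faces :: "nat \<Rightarrow> 'a set \<Rightarrow> 'a set set" where
  "new_faces j \<sigma> = {G. G face_of \<sigma> \<and> aff_dim G = int j \<and> (\<forall>\<rho>\<in>lower_ridges \<sigma>. \<not> G \<subseteq> \<rho>)}"

text \<open>A facet of least value containing \<open>G\<close> counts it. No second facet does: at
  the higher of the two, \<open>descent\<close> yields a lower ridge through \<open>G\<close>, so
  the local test on ridges detects global minimality.\<close>

lemma face_number_eq_sum:
  assumes "int j < aff_dim P"
  shows "face_number P j = (\<Sum>\<sigma>\<in>{\<sigma>. \<sigma> facet_of P}. card (new_faces j \<sigma>))"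
proof -
  let ?\<Sigma> = "{\<sigma>. \<sigma> facet_of P}"
  have fin: "finite ?\<Sigma>"
    using polytope finite_polytope_facets by blast
  have new_face: "G face_of P" if "\<sigma> facet_of P" "G \<in> new_faces j \<sigma>" for G \<sigma>
    using that facet_of_imp_face_of face_of_trans by (metis (no_types, lifting) mem_Collect_eq new_faces_def)
  have disj: False if "\<sigma> facet_of P" "\<tau> facet_of P" "val \<tau> < val \<sigma>" "G \<in> new_faces j \<sigma>" "G \<in> new_faces j \<tau>" for \<sigma> \<tau> G
  proof -
    have "G \<subseteq> \<sigma>" "G \<subseteq> \<tau>" "G \<noteq> {}"
      using that face_of_imp_subset by (auto simp: new_faces_def)
    from descent[OF that(1,2) new_face[OF that(1,4)] this(3,1,2) that(3)]
    obtain \<rho> \<tau>' where "\<rho> facet_of \<sigma>" "G \<subseteq> \<rho>" "\<tau>' facet_of P" "\<rho> \<subseteq> \<tau>'" "val \<tau>' < val \<sigma>"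
      by blast
    with that show False
      by (auto simp: new_faces_def lower_ridges_def)
  qed
  have "{G. G face_of P \<and> aff_dim G = int j} = (\<Union>\<sigma>\<in>?\<Sigma>. new_faces j \<sigma>)"
  proof (intro subset_antisym subsetI)
    fix G assume "G \<in> {G. G face_of P \<and> aff_dim G = int j}"
    then have G: "G face_of P" "aff_dim G = int j" by auto
    then have "G \<noteq> {}" "G \<noteq> P"
      using assms by auto
    then obtain \<sigma>0 where "\<sigma>0 facet_of P" "G \<subseteq> \<sigma>0"
      using face_of_polyhedron_subset_facet[OF polytope_imp_polyhedron[OF polytope] G(1)] by blast
    then have "{\<sigma>. \<sigma> facet_of P \<and> G \<subseteq> \<sigma>} \<noteq> {}" by blast
    moreover have "finite {\<sigma>. \<sigma> facet_of P \<and> G \<subseteq> \<sigma>}"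
      using fin by (rule rev_finite_subset) blast
    ultimately obtain \<sigma> where \<sigma>: "\<sigma> facet_of P" "G \<subseteq> \<sigma>"
      and least: "\<And>\<tau>. \<tau> facet_of P \<Longrightarrow> G \<subseteq> \<tau> \<Longrightarrow> \<not> val \<tau> < val \<sigma>"
      using ex_min_if_finite[of "val ` {\<sigma>. \<sigma> facet_of P \<and> G \<subseteq> \<sigma>}"] by auto
    have "G face_of \<sigma>"
      using G \<sigma> face_of_subset facet_of_imp_subset by blast
    moreover have "\<not> G \<subseteq> \<rho>" if "\<rho> \<in> lower_ridges \<sigma>" for \<rho>
      using that least by (auto simp: lower_ridges_def)
    ultimately show "G \<in> (\<Union>\<sigma>\<in>?\<Sigma>. new_faces j \<sigma>)"
      using G \<sigma> by (auto simp: new_faces_def)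
  next
    fix G assume "G \<in> (\<Union>\<sigma>\<in>?\<Sigma>. new_faces j \<sigma>)"
    then show "G \<in> {G. G face_of P \<and> aff_dim G = int j}"
      using new_face by (auto simp: new_faces_def)
  qed
  moreover have "card (\<Union>\<sigma>\<in>?\<Sigma>. new_faces j \<sigma>) = (\<Sum>\<sigma>\<in>?\<Sigma>. card (new_faces j \<sigma>))"
  proof (rule card_UN_disjoint[OF fin])
    show "\<forall>\<sigma>\<in>?\<Sigma>. finite (new_faces j \<sigma>)"
    proof
      fix \<sigma> assume "\<sigma> \<in> ?\<Sigma>"
      then have "new_faces j \<sigma> \<subseteq> {G. G face_of P}"
        using new_face by blast
      then show "finite (new_faces j \<sigma>)"
        using finite_polytope_faces[OF polytope] finite_subset by blast
    qed
    show "\<forall>\<sigma>\<in>?\<Sigma>. \<forall>\<tau>\<in>?\<Sigma>. \<sigma> \<noteq> \<tau> \<longrightarrow> new_faces j \<sigma> \<inter> new_faces j \<tau> = {}"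
    proof (intro ballI impI)
      fix \<sigma> \<tau> assume st: "\<sigma> \<in> ?\<Sigma>" "\<tau> \<in> ?\<Sigma>" "\<sigma> \<noteq> \<tau>"
      then have "val \<sigma> \<noteq> val \<tau>"
        using inj_val by (auto simp: inj_on_def)
      then show "new_faces j \<sigma> \<inter> new_faces j \<tau> = {}"
        using st disj[of \<sigma> \<tau>] disj[of \<tau> \<sigma>] by (cases "val \<tau> < val \<sigma>") auto
    qed
  qed
  ultimately show ?thesis
    by (simp add: face_number_def)
qed

end

text \<open>Replacing \<open>c\<close> by \<open>-c\<close> reverses the order. Exactly one other
  facet lies behind each ridge of \<sigma>, so the ridge is lower in exactly one of the two
  orders.\<close>

lemma ex_facet_order:
  fixes P :: "'a::euclidean_space set"
  assumes "polytope P" "P \<noteq> {}"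
  shows "\<exists>val. facet_order P val \<and> facet_order P (\<lambda>\<sigma>. - val \<sigma>) \<and>
    (\<forall>\<sigma>. \<sigma> facet_of P \<longrightarrow> facet_order.lower_ridges P (\<lambda>\<sigma>. - val \<sigma>) \<sigma>
       = {\<rho>. \<rho> facet_of \<sigma>} - facet_order.lower_ridges P val \<sigma>)"
proof -
  have "convex P"
    using assms polytope_imp_convex by blast
  then obtain p where "p \<in> rel_interior P"
    using assms rel_interior_eq_empty by blast
  then interpret pointed_polytope P p
    using assms by unfold_locales
  obtain c where c: "c \<in> dirs" "inj_on (\<lambda>\<sigma>. normal \<sigma> \<bullet> c) {\<sigma>. \<sigma> facet_of P}"
    using ex_generic_direction by blast
  define val where "val = (\<lambda>\<sigma>. normal \<sigma> \<bullet> c)"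
  interpret up: facet_order P val
    using polytope c(2) lower_facet_across_ridge[OF _ _ _ _ _ _ c(1)]
    unfolding val_def by unfold_locales
  have c': "- c \<in> dirs"
    using subspace_neg[OF subspace_dirs] c by blast
  interpret down: facet_order P "\<lambda>\<sigma>. - val \<sigma>"
  proof
    show "inj_on (\<lambda>\<sigma>. - val \<sigma>) {\<sigma>. \<sigma> facet_of P}"
      using c(2) by (auto simp: val_def inj_on_def)
    show "\<exists>\<rho> \<tau>'. \<rho> facet_of \<sigma> \<and> G \<subseteq> \<rho> \<and> \<tau>' facet_of P \<and> \<rho> \<subseteq> \<tau>' \<and> - val \<tau>' < - val \<sigma>"
      if "\<sigma> facet_of P" "\<tau> facet_of P" "G face_of P" "G \<noteq> {}" "G \<subseteq> \<sigma>" "G \<subseteq> \<tau>" "- val \<tau> < - val \<sigma>" for \<sigma> \<tau> G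
      using lower_facet_across_ridge[OF that(1-6) c'] that(7) by (simp add: val_def)
  qed (rule polytope)
  have "down.lower_ridges \<sigma> = {\<rho>. \<rho> facet_of \<sigma>} - up.lower_ridges \<sigma>" if \<sigma>: "\<sigma> facet_of P" for \<sigma>
  proof -
    have "(\<exists>\<tau>. \<tau> facet_of P \<and> \<rho> \<subseteq> \<tau> \<and> - val \<tau> < - val \<sigma>) \<longleftrightarrow>
        \<not> (\<exists>\<tau>. \<tau> facet_of P \<and> \<rho> \<subseteq> \<tau> \<and> val \<tau> < val \<sigma>)" if \<rho>: "\<rho> facet_of \<sigma>" for \<rho>
    proof -
      obtain \<tau>0 where \<tau>0: "\<tau>0 facet_of P" "\<tau>0 \<noteq> \<sigma>" "\<rho> \<subseteq> \<tau>0"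
        using ridge_in_other_facet[OF \<sigma> \<rho>] by blast
      then have "val \<tau>0 \<noteq> val \<sigma>"
        using up.inj_val \<sigma> by (auto simp: inj_on_def)
      have uniq: "\<tau> = \<tau>0 \<or> \<tau> = \<sigma>" if "\<tau> facet_of P" "\<rho> \<subseteq> \<tau>" for \<tau>
        using ridge_in_two_facets[OF \<sigma> \<rho> \<tau>0(1,3,2) that] by blast
      show ?thesis
      proof
        assume "\<exists>\<tau>. \<tau> facet_of P \<and> \<rho> \<subseteq> \<tau> \<and> - val \<tau> < - val \<sigma>"
        then have "val \<tau>0 > val \<sigma>"
          using uniq by force
        then show "\<not> (\<exists>\<tau>. \<tau> facet_of P \<and> \<rho> \<subseteq> \<tau> \<and> val \<tau> < val \<sigma>)"
          using uniq by force
      next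
        assume "\<not> (\<exists>\<tau>. \<tau> facet_of P \<and> \<rho> \<subseteq> \<tau> \<and> val \<tau> < val \<sigma>)"
        then show "\<exists>\<tau>. \<tau> facet_of P \<and> \<rho> \<subseteq> \<tau> \<and> - val \<tau> < - val \<sigma>"
          using \<tau>0 \<open>val \<tau>0 \<noteq> val \<sigma>\<close> by (intro exI[of _ \<tau>0]) auto
      qed
    qed
    then show ?thesis
      unfolding up.lower_ridges_def down.lower_ridges_def by blast
  qed
  then show ?thesis
    using up.facet_order_axioms down.facet_order_axioms by blast
qed

section \<open>Cubical polytopes\<close>

text \<open>A facet \<sigma> through \<open>v\<close> is a cube and supplies \<open>d - 1\<close>
  edges. In a second facet \<tau> through \<open>v\<close>, the proper face
  \<open>\<sigma> \<inter> \<tau>\<close> cannot contain all edges at \<open>v\<close>, which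
  supplies one more.\<close>

lemma cubical_vertex_degree:
  assumes cub: "cubical_polytope d P" and "2 \<le> d" and v: "v face_of P" "aff_dim v = 0"
  shows "d \<le> card {e. e face_of P \<and> aff_dim e = 1 \<and> v \<subseteq> e}"
proof -
  have P: "polytope P" "aff_dim P = int d" and cube: "\<And>\<sigma>. \<sigma> facet_of P \<Longrightarrow> combinatorial_cube (d - 1) \<sigma>"
    using cub by (auto simp: cubical_polytope_def)
  have "v \<noteq> {}" "v \<noteq> P"
    using v P \<open>2 \<le> d\<close> by auto
  then obtain \<sigma> where \<sigma>: "\<sigma> facet_of P" "v \<subseteq> \<sigma>"
    using face_of_polyhedron_subset_facet[OF polytope_imp_polyhedron[OF P(1)] v(1)] by metis
  have "\<exists>\<tau>. \<tau> facet_of P \<and> v \<subseteq> \<tau> \<and> \<tau> \<noteq> \<sigma>"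
  proof (rule ccontr)
    assume "\<not> ?thesis"
    then have "{\<tau>. \<tau> facet_of P \<and> v \<subseteq> \<tau>} = {\<sigma>}"
      using \<sigma> by blast
    then have "v = \<sigma>"
      using face_of_polyhedron[OF polytope_imp_polyhedron[OF P(1)] v(1) \<open>v \<noteq> {}\<close> \<open>v \<noteq> P\<close>] by simp
    with v \<sigma> P \<open>2 \<le> d\<close> show False
      by (simp add: facet_of_def)
  qed
  then obtain \<tau> where \<tau>: "\<tau> facet_of P" "v \<subseteq> \<tau>" "\<tau> \<noteq> \<sigma>"
    by blast
  have faces: "\<sigma> face_of P" "\<tau> face_of P"
    using \<sigma> \<tau> facet_of_imp_face_of by blast+
  have poly: "polytope \<sigma>" "polytope \<tau>"
    using faces P(1) face_of_polytope_polytope by blast+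
  have v': "v face_of \<sigma>" "v face_of \<tau>"
    using face_of_subset[OF v(1)] \<sigma> \<tau> faces face_of_imp_subset by blast+
  obtain B :: "'a set" and f where "cube_coords B f \<sigma>" and B: "card B = d - 1"
    using combinatorial_cube_coords[OF cube[OF \<sigma>(1)] poly(1)] by blast
  then interpret \<sigma>: cube_coords B f \<sigma> by simp
  obtain E where E: "inj_on E B" "\<And>i. i \<in> B \<Longrightarrow> E i face_of \<sigma> \<and> aff_dim (E i) = 1 \<and> v \<subseteq> E i"
    using \<sigma>.vertex_edges[OF v'(1) v(2)] by metis
  obtain B' :: "'a set" and f' where "cube_coords B' f' \<tau>"
    using combinatorial_cube_coords[OF cube[OF \<tau>(1)] poly(2)] by blast
  then interpret \<tau>: cube_coords B' f' \<tau> by simp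
  have "\<sigma> \<inter> \<tau> face_of P"
    using faces face_of_Int by blast
  then have H: "\<sigma> \<inter> \<tau> face_of \<tau>"
    using face_of_subset[of "\<sigma> \<inter> \<tau>" P \<tau>] faces face_of_imp_subset by blast
  have "\<sigma> \<inter> \<tau> \<noteq> \<tau>"
    using facet_of_subset_eq[OF \<tau>(1) \<sigma>(1)] \<tau>(3) by blast
  moreover have "v \<subseteq> \<sigma> \<inter> \<tau>"
    using \<sigma> \<tau> by blast
  ultimately obtain e where e: "e face_of \<tau>" "aff_dim e = 1" "v \<subseteq> e" "\<not> e \<subseteq> \<sigma> \<inter> \<tau>"
    using \<tau>.vertex_edges[OF v'(2) v(2)] H by metis
  have "\<not> e \<subseteq> \<sigma>"
    using e face_of_imp_subset by blast
  then have "e \<notin> E ` B"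
    using E(2) face_of_imp_subset by blast
  then have "card (insert e (E ` B)) = Suc (card B)"
    using E(1) \<sigma>.fin by (simp add: card_image)
  then have "d = card (insert e (E ` B))"
    using B \<open>2 \<le> d\<close> by simp
  also have "\<dots> \<le> card {e. e face_of P \<and> aff_dim e = 1 \<and> v \<subseteq> e}"
  proof (rule card_mono)
    show "finite {e. e face_of P \<and> aff_dim e = 1 \<and> v \<subseteq> e}"
      using finite_polytope_faces[OF P(1)] by (rule rev_finite_subset) blast
    have "e face_of P" "\<And>i. i \<in> B \<Longrightarrow> E i face_of P"
      using e E(2) faces face_of_trans by blast+
    with e E(2) show "insert e (E ` B) \<subseteq> {e. e face_of P \<and> aff_dim e = 1 \<and> v \<subseteq> e}"
      by blast
  qed
  finally show ?thesis .
qed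

text \<open>Of three collinear points one lies between the other two, so it is not extreme.\<close>

lemma card_vertices_of_edge:
  fixes e :: "'a::euclidean_space set"
  assumes "aff_dim e = 1"
  shows "card {v. v face_of e \<and> aff_dim v = 0} \<le> 2"
proof (rule ccontr)
  let ?V = "{v. v face_of e \<and> aff_dim v = 0}"
  assume "\<not> card ?V \<le> 2"
  then obtain S where S: "S \<subseteq> ?V" "card S = 3"
    using obtain_subset_with_card_n[of 3 ?V] by auto
  then obtain u v w where uvw: "S = {u, v, w}" "u \<noteq> v" "v \<noteq> w" "u \<noteq> w"
    by (auto simp: card_3_iff)
  obtain x y z where xyz: "u = {x}" "v = {y}" "w = {z}"
    using S uvw by (auto simp: aff_dim_eq_0)
  have face: "{x} face_of e" "{y} face_of e" "{z} face_of e"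
    using S uvw xyz by auto
  then have in_e: "x \<in> e" "y \<in> e" "z \<in> e"
    using face_of_imp_subset by blast+
  have not_open: "a \<notin> open_segment b c" if "{a} face_of e" "b \<in> e" "c \<in> e" "b \<noteq> a" for a b c
    using face_ofD[OF that(1), of a b c] that by blast
  have "aff_dim {x, y, z} \<le> aff_dim e"
    using in_e by (intro aff_dim_subset) auto
  then have "collinear {x, y, z}"
    using assms by (simp add: collinear_aff_dim)
  then have "between (y, z) x \<or> between (z, x) y \<or> between (x, y) z"
    by (simp add: collinear_between_cases)
  then have "x \<in> open_segment y z \<or> y \<in> open_segment z x \<or> z \<in> open_segment x y"
    using uvw xyz by (auto simp: between_mem_segment open_segment_def)
  then show False
    using not_open[OF face(1), of y z] not_open[OF face(2), of z x] not_open[OF face(3), of x y] in_e uvw xyz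
    by auto
qed

text \<open>Double counting of incident pairs of a vertex and an edge.\<close>

lemma cubical_f0_f1:
  assumes cub: "cubical_polytope d P" and "2 \<le> d"
  shows "d * face_number P 0 \<le> 2 * face_number P 1"
proof -
  have P: "polytope P"
    using cub by (auto simp: cubical_polytope_def)
  define V where "V = {v. v face_of P \<and> aff_dim v = 0}"
  define E where "E = {e. e face_of P \<and> aff_dim e = 1}"
  have fin: "finite V" "finite E"
    unfolding V_def E_def using finite_polytope_faces[OF P] by (auto intro: rev_finite_subset)
  have "d * card V = (\<Sum>v\<in>V. d)"
    by simp
  also have "\<dots> \<le> (\<Sum>v\<in>V. card {e\<in>E. v \<subseteq> e})"
    using cubical_vertex_degree[OF assms] by (intro sum_mono) (auto simp: V_def E_def conj_assoc)
  also have "\<dots> = (\<Sum>v\<in>V. \<Sum>e\<in>E. if v \<subseteq> e then 1 else 0)"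
    using fin by (simp add: sum.inter_filter[symmetric])
  also have "\<dots> = (\<Sum>e\<in>E. \<Sum>v\<in>V. if v \<subseteq> e then 1 else 0)"
    by (rule sum.swap)
  also have "\<dots> = (\<Sum>e\<in>E. card {v\<in>V. v \<subseteq> e})"
    using fin by (simp add: sum.inter_filter[symmetric])
  also have "\<dots> \<le> (\<Sum>e\<in>E. 2)"
  proof (rule sum_mono)
    fix e assume "e \<in> E"
    then have e: "e face_of P" "aff_dim e = 1"
      by (auto simp: E_def)
    have "{v\<in>V. v \<subseteq> e} \<subseteq> {v. v face_of e \<and> aff_dim v = 0}"
      using face_of_subset[OF _ _ face_of_imp_subset[OF e(1)]] by (auto simp: V_def)
    moreover have "finite {v. v face_of e \<and> aff_dim v = 0}"
      using finite_polytope_faces[OF face_of_polytope_polytope[OF P e(1)]] by (rule rev_finite_subset) blast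
    ultimately have "card {v\<in>V. v \<subseteq> e} \<le> card {v. v face_of e \<and> aff_dim v = 0}"
      by (intro card_mono)
    also have "\<dots> \<le> 2"
      using e(2) by (rule card_vertices_of_edge)
    finally show "card {v\<in>V. v \<subseteq> e} \<le> 2" .
  qed
  finally show ?thesis
    by (simp add: V_def E_def face_number_def)
qed

theorem theorem3:
  fixes d :: nat and P :: "'a::euclidean_space set"
  assumes "d \<le> 10" and "cubical_polytope d P"
  shows "unimodal (face_vector d P)"
proof (cases d)
  case 0
  then show ?thesis
    by (simp add: face_vector_def unimodal_def)
next
  case (Suc n)
  have P: "polytope P" "aff_dim P = int d" and cube: "\<And>\<sigma>. \<sigma> facet_of P \<Longrightarrow> combinatorial_cube n \<sigma>"
    using assms Suc by (auto simp: cubical_polytope_def)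
  have "P \<noteq> {}"
    using P by auto
  let ?\<Sigma> = "{\<sigma>. \<sigma> facet_of P}"
  obtain val where "facet_order P val" "facet_order P (\<lambda>\<sigma>. - val \<sigma>)"
    and upper: "\<And>\<sigma>. \<sigma> facet_of P \<Longrightarrow> facet_order.lower_ridges P (\<lambda>\<sigma>. - val \<sigma>) \<sigma>
       = {\<rho>. \<rho> facet_of \<sigma>} - facet_order.lower_ridges P val \<sigma>"
    using ex_facet_order[OF P(1) \<open>P \<noteq> {}\<close>] by blast
  then interpret up: facet_order P val + down: facet_order P "\<lambda>\<sigma>. - val \<sigma>"
    by simp_all
  \<comment> \<open>Both counts are obtained together because the same triple must serve the order
    and its reversal.\<close>
  have "\<exists>a b c. a + b + c = n \<and>
      (\<forall>j. int (card (up.new_faces j \<sigma>)) = coeff (box_poly a b c) j) \<and>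
      (\<forall>j. int (card (down.new_faces j \<sigma>)) = coeff (box_poly c b a) j)" if \<sigma>: "\<sigma> facet_of P" for \<sigma>
  proof -
    have poly: "polytope \<sigma>"
      using face_of_polytope_polytope[OF P(1)] facet_of_imp_face_of[OF \<sigma>] by blast
    have lower: "up.lower_ridges \<sigma> \<subseteq> {\<rho>. \<rho> facet_of \<sigma>}"
      by (auto simp: up.lower_ridges_def)
    show ?thesis
      unfolding up.new_faces_def down.new_faces_def upper[OF \<sigma>]
      by (rule cube_faces_count[OF cube[OF \<sigma>] poly lower]) (intro exI conjI allI; assumption)
  qed
  then obtain a b c where abc: "\<And>\<sigma>. \<sigma> facet_of P \<Longrightarrow> a \<sigma> + b \<sigma> + c \<sigma> = n"
    and up: "\<And>\<sigma> j. \<sigma> facet_of P \<Longrightarrow> int (card (up.new_faces j \<sigma>)) = coeff (box_poly (a \<sigma>) (b \<sigma>) (c \<sigma>)) j"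
    and down: "\<And>\<sigma> j. \<sigma> facet_of P \<Longrightarrow> int (card (down.new_faces j \<sigma>)) = coeff (box_poly (c \<sigma>) (b \<sigma>) (a \<sigma>)) j"
    by metis
  have "unimodal (map (face_number P) [0..<Suc n])"
  proof (rule unimodal_from_box_polys)
    show "n \<le> 9"
      using assms Suc by simp
    show "a \<sigma> + b \<sigma> + c \<sigma> = n" if "\<sigma> \<in> ?\<Sigma>" for \<sigma>
      using abc that by simp
    show "2 * int (face_number P j) = (\<Sum>\<sigma>\<in>?\<Sigma>. sym_coeff (a \<sigma>) (b \<sigma>) (c \<sigma>) j)" if "j \<le> n" for j
    proof -
      have j: "int j < aff_dim P"
        using that P Suc by simp
      have "int (face_number P j) = (\<Sum>\<sigma>\<in>?\<Sigma>. coeff (box_poly (a \<sigma>) (b \<sigma>) (c \<sigma>)) j)"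
        unfolding up.face_number_eq_sum[OF j] by (simp add: up)
      moreover have "int (face_number P j) = (\<Sum>\<sigma>\<in>?\<Sigma>. coeff (box_poly (c \<sigma>) (b \<sigma>) (a \<sigma>)) j)"
        unfolding down.face_number_eq_sum[OF j] by (simp add: down)
      ultimately show ?thesis
        by (simp add: sym_coeff_def sum.distrib)
    qed
    show "10 * face_number P 0 \<le> 2 * face_number P 1" if "n = 9"
      using cubical_f0_f1[OF assms(2)] Suc that by simp
  qed
  then show ?thesis
    by (simp add: face_vector_def Suc)
qed

end
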